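(* Let $(X_n)_{n\in\mathbb{Z}}$ be the stationary INAR($\infty$) process with reproduction coefficients $\alpha_k\ge0$, $k\in\mathbb{N}$, such that $K:=\sum_{k=1}^\infty\alpha_k<1$, and immigration parameter $\alpha_0\ge0$. Let $R(j):=\mathrm{Cov}(X_n,X_{n+j})$, $j\in\mathbb{Z}$, be its autocovariance function. Then $$R(j)=\frac{\alpha_0}{1-K}\sum_{k=0}^\infty\beta_k\beta_{k+|j|}\ge0,\qquad j\in\mathbb{Z},$$ where $\beta_0:=1$ and $\beta_k:=\sum_{i=1}^k\alpha_i\beta_{k-i}$ for $k\in\mathbb{N}$. In addition, $$\sum_{j=0}^\infty R(j)\le\frac{\alpha_0}{(1-K)^3}<\infty.$$
   Context: INAR($\infty$): Given $\alpha_k\ge0$ ($k\in\mathbb{N}_0$) with $K=\sum_{k\ge1}\alpha_k<1$, let $\varepsilon_n$, $n\in\mathbb{Z}$, be i.i.d. $\mathrm{Pois}(\alpha_0)$ and $\xi^{(n,k)}_l\sim\mathrm{Pois}(\alpha_k)$ independently over $n\in\mathbb{Z}$, $k,l\in\mathbb{N}$ and independent of $(\varepsilon_n)$. The INAR($\infty$) process with immigration parameter $\alpha_0$ and reproduction coefficients $\alpha_k$, $k\in\mathbb{N}$, is the almost surely unique (strictly) stationary $\mathbb{N}_0$-valued solution $(X_n)_{n\in\mathbb{Z}}$ of $X_n=\varepsilon_n+\sum_{k=1}^\infty\sum_{l=1}^{X_{n-k}}\xi^{(n,k)}_l$, $n\in\mathbb{Z}$, where $\varepsilon_n$ and $(\xi^{(n,k)}_l)_{k,l}$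 are independent of $X_{n-1},X_{n-2},\dots$. It satisfies $\mathbb{E}X_n=\alpha_0/(1-K)$. *)

theory Defs
  imports "HOL-Probability.Probability"
begin

(* The library's poisson_pmf is only specified for positive rates; Pois(0) is the point mass at 0. *)
definition pois :: "real \<Rightarrow> nat pmf" where
  "pois r = (if r = 0 then return_pmf 0 else poisson_pmf r)"

definition covariance :: "'a measure \<Rightarrow> ('a \<Rightarrow> real) \<Rightarrow> ('a \<Rightarrow> real) \<Rightarrow> real" where
  "covariance M X Y =
     (\<integral>\<omega>. (X \<omega> - (\<integral>\<omega>'. X \<omega>' \<partial>M)) * (Y \<omega> - (\<integral>\<omega>'. Y \<omega>' \<partial>M)) \<partial>M)"

definition strictly_stationary :: "'a measure \<Rightarrow> (int \<Rightarrow> 'a \<Rightarrow> nat) \<Rightarrow> bool" where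
  "strictly_stationary M X \<longleftrightarrow>
     (\<forall>h. distr M (PiM UNIV (\<lambda>_. count_space UNIV)) (\<lambda>\<omega> n. X (n + h) \<omega>)
        = distr M (PiM UNIV (\<lambda>_. count_space UNIV)) (\<lambda>\<omega> n. X n \<omega>))"

(* Only the variables \<xi> n k l with k, l \<ge> 1 matter; the others are unconstrained. *)
definition inar_noise ::
  "'a measure \<Rightarrow> (nat \<Rightarrow> real) \<Rightarrow> (int \<Rightarrow> 'a \<Rightarrow> nat) \<Rightarrow> (int \<Rightarrow> nat \<Rightarrow> nat \<Rightarrow> 'a \<Rightarrow> nat) \<Rightarrow> bool"
where
  "inar_noise M \<alpha> \<epsilon> \<xi> \<longleftrightarrow>
     prob_space M \<and>
     prob_space.indep_vars M (\<lambda>_. count_space UNIV)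
       (case_sum \<epsilon> (\<lambda>(n, k, l). \<xi> n k l)) (UNIV <+> (UNIV \<times> {1..} \<times> {1..})) \<and>
     (\<forall>n. distr M (count_space UNIV) (\<epsilon> n) = measure_pmf (pois (\<alpha> 0))) \<and>
     (\<forall>n. \<forall>k\<ge>1. \<forall>l\<ge>1. distr M (count_space UNIV) (\<xi> n k l) = measure_pmf (pois (\<alpha> k)))"

(* The \<sigma>-algebra generated by \<epsilon> n and all \<xi> n k l, k, l \<ge> 1. *)
definition noise_sigma ::
  "'a measure \<Rightarrow> (int \<Rightarrow> 'a \<Rightarrow> nat) \<Rightarrow> (int \<Rightarrow> nat \<Rightarrow> nat \<Rightarrow> 'a \<Rightarrow> nat) \<Rightarrow> int \<Rightarrow> 'a set set"
where
  "noise_sigma M \<epsilon> \<xi> n = sets (vimage_algebra (space M)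
     (\<lambda>\<omega>. (\<epsilon> n \<omega>, \<lambda>p\<in>{1..} \<times> {1..}. \<xi> n (fst p) (snd p) \<omega>))
     (count_space UNIV \<Otimes>\<^sub>M PiM ({1..} \<times> {1..}) (\<lambda>_. count_space UNIV)))"

(* The \<sigma>-algebra generated by X (n - 1), X (n - 2), ... *)
definition past_sigma :: "'a measure \<Rightarrow> (int \<Rightarrow> 'a \<Rightarrow> nat) \<Rightarrow> int \<Rightarrow> 'a set set" where
  "past_sigma M X n = sets (vimage_algebra (space M)
     (\<lambda>\<omega>. \<lambda>m\<in>{..<n}. X m \<omega>) (PiM {..<n} (\<lambda>_. count_space UNIV)))"

(* The recursion is read in ennreal, so it includes the convergence of the series.
   The summation index k runs from 0, so that Suc k is the lag. *)
definition stationary_inar_solution ::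
  "'a measure \<Rightarrow> (int \<Rightarrow> 'a \<Rightarrow> nat) \<Rightarrow> (int \<Rightarrow> nat \<Rightarrow> nat \<Rightarrow> 'a \<Rightarrow> nat) \<Rightarrow> (int \<Rightarrow> 'a \<Rightarrow> nat) \<Rightarrow> bool"
where
  "stationary_inar_solution M \<epsilon> \<xi> X \<longleftrightarrow>
     (\<forall>n. X n \<in> measurable M (count_space UNIV)) \<and>
     strictly_stationary M X \<and>
     (\<forall>n. AE \<omega> in M. (of_nat (X n \<omega>) :: ennreal) = of_nat (\<epsilon> n \<omega>) +
        (\<Sum>k. of_nat (\<Sum>l = 1..X (n - int (Suc k)) \<omega>. \<xi> n (Suc k) l \<omega>))) \<and>
     (\<forall>n. prob_space.indep_set M (noise_sigma M \<epsilon> \<xi> n) (past_sigma M X n))"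

(* The INAR(infinity) process is by definition the almost surely unique stationary solution,
   whence the last clause. *)
definition inar_process ::
  "'a measure \<Rightarrow> (nat \<Rightarrow> real) \<Rightarrow> (int \<Rightarrow> 'a \<Rightarrow> nat) \<Rightarrow> (int \<Rightarrow> nat \<Rightarrow> nat \<Rightarrow> 'a \<Rightarrow> nat)
     \<Rightarrow> (int \<Rightarrow> 'a \<Rightarrow> nat) \<Rightarrow> bool"
where
  "inar_process M \<alpha> \<epsilon> \<xi> X \<longleftrightarrow>
     inar_noise M \<alpha> \<epsilon> \<xi> \<and>
     stationary_inar_solution M \<epsilon> \<xi> X \<and>
     (\<forall>X'. stationary_inar_solution M \<epsilon> \<xi> X' \<longrightarrow> (AE \<omega> in M. \<forall>n. X' n \<omega> = X n \<omega>))"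

function inar_beta :: "(nat \<Rightarrow> real) \<Rightarrow> nat \<Rightarrow> real" where
  "inar_beta \<alpha> k = (if k = 0 then 1 else (\<Sum>i = 1..k. \<alpha> i * inar_beta \<alpha> (k - i)))"
  by auto
termination by (relation "Wellfounded.measure snd") auto

declare inar_beta.simps [simp del]

end

theory Submission
  imports Defs
begin

text \<open>
  Nothing is assumed about the moments of \<open>X\<close>; their finiteness is obtained from the
  uniqueness of the stationary solution: iterating the recursion from the zero process gives increasing
  approximations whose first and second moments stay bounded (because \<open>K < 1\<close>), and their
  limit is a stationary solution, hence almost surely equal to \<open>X\<close>.

  Given the past, \<open>X n\<close> is a sum of independent Poisson variables with total rate
  \<open>L = \<alpha> 0 + (\<Sum>k. \<alpha> (Suc k) * X (n - Suc k))\<close>. Hence \<open>E (V * X n) = E (V * L)\<close> for every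
  nonnegative \<open>V\<close> depending on the past only, and \<open>E (X n)\<^sup>2 = E L\<^sup>2 + E L\<close>. With \<open>V = X m\<close>
  and \<open>V = L\<close> this gives the Yule--Walker equations
  \<open>R j = (if j = 0 then \<mu> else 0) + (\<Sum>k. \<alpha> (Suc k) * R (j - Suc k))\<close> for \<open>j \<ge> 0\<close>, where
  \<open>\<mu> = \<alpha> 0 / (1 - K)\<close> is the mean. The claimed formula solves the same equations, and since
  \<open>K < 1\<close> they have only one bounded even solution.
\<close>

section \<open>The sequence beta and the Yule--Walker equations\<close>

text \<open>The moment equations alone do not exclude infinite moments: \<infinity> also solves m =
  \<alpha> 0 + K * m, and for a non-integrable product the Bochner integral in
  \<open>covariance\<close> would be a mere default value. The bound therefore has to come from an
  explicit solution, built as a function of the noise. For the same reason moment identities are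
  proved in ennreal, where sums and integrals commute without integrability, and are moved to the
  reals only after a bound is known.

  The other obstacle is the random upper limit of the inner sums. Each is rewritten as a sum over
  all potential individuals, weighted by the indicator that the individual exists. The indicator is
  known from the past, the offspring count belongs to the noise at time n, so products factor by
  independence. No conditional distribution is formed; only the first two moments of the noise
  enter.\<close>

lemma inar_beta_0 [simp]: "inar_beta \<alpha> 0 = 1"
  by (simp add: inar_beta.simps)

lemma inar_beta_Suc: "inar_beta \<alpha> (Suc k) = (\<Sum>i\<le>k. \<alpha> (Suc i) * inar_beta \<alpha> (k - i))"
  by (subst inar_beta.simps)
     (auto simp: sum.atLeast_Suc_atMost_Suc_shift atMost_atLeast0 simp del: sum.cl_ivl_Suc)

lemma bounded_convolution_solution_eq_0:
  fixes a d :: "nat \<Rightarrow> real"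
  assumes a: "\<And>k. a k \<ge> 0" "a sums K" "K < 1"
    and bdd: "\<And>j. \<bar>d j\<bar> \<le> D"
    and eq: "\<And>j. d j = (\<Sum>k. a k * d (nat \<bar>int j - int (Suc k)\<bar>))"
  shows "d j = 0"
proof -
  have K: "K \<ge> 0"
    using a(1,2) sums_le[of "\<lambda>_. 0" a 0 K] by auto
  have bound: "\<bar>d j\<bar> \<le> D * K ^ n" for n j
  proof (induction n arbitrary: j)
    case 0
    show ?case using bdd by simp
  next
    case (Suc n)
    let ?f = "\<lambda>k. a k * d (nat \<bar>int j - int (Suc k)\<bar>)"
    have le: "norm (?f k) \<le> a k * (D * K ^ n)" for k
      using Suc a(1) by (simp add: abs_mult mult_left_mono)
    have s: "(\<lambda>k. a k * (D * K ^ n)) sums (K * (D * K ^ n))"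
      by (intro sums_mult2 a)
    have summ: "summable (\<lambda>k. norm (?f k))"
      by (rule summable_comparison_test'[OF sums_summable[OF s]]) (use le in auto)
    have "\<bar>d j\<bar> \<le> (\<Sum>k. norm (?f k))"
      using summable_norm[OF summ] by (subst eq) simp
    also have "\<dots> \<le> K * (D * K ^ n)"
      using suminf_le[OF le summ sums_summable[OF s]] sums_unique[OF s] by simp
    finally show ?case by (simp add: mult_ac)
  qed
  have "(\<lambda>n. D * K ^ n) \<longlonglongrightarrow> D * 0"
    using K a(3) by (intro tendsto_mult tendsto_const LIMSEQ_power_zero) auto
  then have "\<bar>d j\<bar> \<le> D * 0"
    by (rule LIMSEQ_le_const) (use bound in auto)
  then show ?thesis by simp
qed

text \<open>The autocorrelation of beta, which will be the autocovariance divided by the mean. In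
  branching terms, beta at k is the expected number of descendants alive k steps after an
  individual.\<close>

definition inar_gamma :: "(nat \<Rightarrow> real) \<Rightarrow> nat \<Rightarrow> real" where
  "inar_gamma \<alpha> j = (\<Sum>k. inar_beta \<alpha> k * inar_beta \<alpha> (k + j))"

context
  fixes \<alpha> :: "nat \<Rightarrow> real" and K :: real
  assumes nonneg: "\<And>k. \<alpha> k \<ge> 0" and sums: "(\<lambda>k. \<alpha> (Suc k)) sums K" and K_less: "K < 1"
begin

lemma inar_beta_nonneg: "inar_beta \<alpha> k \<ge> 0"
proof (induction k rule: less_induct)
  case (less k)
  then show ?case
    by (cases k) (auto simp: inar_beta_Suc intro!: sum_nonneg mult_nonneg_nonneg nonneg)
qed

text \<open>Enlarging the triangle of the convolution to a square bounds the next partial sum by 1 +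
  K times the current one; 1 / (1 - K) is the fixed point of this map.\<close>

lemma sum_inar_beta_le: "(\<Sum>k<n. inar_beta \<alpha> k) \<le> 1 / (1 - K)"
proof (induction n)
  case 0
  then show ?case using K_less by simp
next
  case (Suc n)
  have "(\<Sum>k<n. inar_beta \<alpha> (Suc k)) = (\<Sum>k<n. \<Sum>i\<le>k. \<alpha> (Suc i) * inar_beta \<alpha> (k - i))"
    by (simp add: inar_beta_Suc)
  also have "\<dots> = (\<Sum>(i,j)\<in>{(i,j). i + j < n}. \<alpha> (Suc i) * inar_beta \<alpha> j)"
    by (simp add: sum.triangle_reindex)
  also have "\<dots> \<le> (\<Sum>(i,j)\<in>{..<n} \<times> {..<n}. \<alpha> (Suc i) * inar_beta \<alpha> j)"
    by (rule sum_mono2) (auto intro!: mult_nonneg_nonneg nonneg inar_beta_nonneg)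
  also have "\<dots> = (\<Sum>i<n. \<alpha> (Suc i)) * (\<Sum>j<n. inar_beta \<alpha> j)"
    by (simp add: sum_product sum.cartesian_product)
  also have "\<dots> \<le> K * (1 / (1 - K))"
    using Suc sum_le_suminf[OF sums_summable[OF sums], of "{..<n}"] nonneg sums_unique[OF sums]
    by (intro mult_mono) (auto intro!: sum_nonneg inar_beta_nonneg simp: suminf_nonneg[OF sums_summable[OF sums]])
  finally have "(\<Sum>k<Suc n. inar_beta \<alpha> k) \<le> 1 + K * (1 / (1 - K))"
    by (simp add: sum.lessThan_Suc_shift del: sum.lessThan_Suc)
  also have "\<dots> = 1 / (1 - K)"
    using K_less by (simp add: field_simps)
  finally show ?case .
qed

lemma summable_inar_beta: "summable (inar_beta \<alpha>)"
  by (rule summableI_nonneg_bounded[OF inar_beta_nonneg sum_inar_beta_le])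

lemma suminf_inar_beta_le: "(\<Sum>k. inar_beta \<alpha> k) \<le> 1 / (1 - K)"
  by (rule suminf_le_const[OF summable_inar_beta sum_inar_beta_le])

lemma inar_beta_le: "inar_beta \<alpha> k \<le> 1 / (1 - K)"
  using sum_inar_beta_le[of "Suc k"] sum_nonneg[of "{..<k}" "inar_beta \<alpha>"] inar_beta_nonneg
  by fastforce

lemma summable_inar_gamma: "summable (\<lambda>k. inar_beta \<alpha> k * inar_beta \<alpha> (k + j))"
proof (rule summable_comparison_test'[OF summable_mult2[OF summable_inar_beta]])
  show "norm (inar_beta \<alpha> k * inar_beta \<alpha> (k + j)) \<le> inar_beta \<alpha> k * (1 / (1 - K))" for k
    using inar_beta_nonneg inar_beta_le by (simp add: abs_mult mult_left_mono del: times_divide_eq_right)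
qed

lemma inar_gamma_nonneg: "inar_gamma \<alpha> j \<ge> 0"
  unfolding inar_gamma_def
  by (intro suminf_nonneg summable_inar_gamma mult_nonneg_nonneg inar_beta_nonneg)

text \<open>For fixed \<open>k\<close> the sum over \<open>j\<close> runs over a window of beta, so
  it costs one factor 1 / (1 - K); the remaining sum over \<open>k\<close> costs the second.\<close>

lemma sum_inar_gamma_le: "(\<Sum>j<n. inar_gamma \<alpha> j) \<le> 1 / (1 - K)\<^sup>2"
proof -
  have "(\<Sum>j<n. inar_gamma \<alpha> j) = (\<Sum>k. inar_beta \<alpha> k * (\<Sum>j<n. inar_beta \<alpha> (k + j)))"
    unfolding inar_gamma_def sum_distrib_left by (rule suminf_sum[symmetric, OF summable_inar_gamma])
  also have "\<dots> \<le> (\<Sum>k. inar_beta \<alpha> k * (1 / (1 - K)))"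
  proof (rule suminf_le)
    fix k
    have "(\<Sum>j<n. inar_beta \<alpha> (k + j)) = (\<Sum>j=k..<k + n. inar_beta \<alpha> j)"
      by (rule sum.reindex_bij_witness[of _ "\<lambda>j. j - k" "\<lambda>j. j + k"]) (auto simp: add.commute)
    also have "\<dots> \<le> (\<Sum>j<k + n. inar_beta \<alpha> j)"
      by (rule sum_mono2) (auto intro: inar_beta_nonneg)
    also have "\<dots> \<le> 1 / (1 - K)"
      by (rule sum_inar_beta_le)
    finally show "inar_beta \<alpha> k * (\<Sum>j<n. inar_beta \<alpha> (k + j)) \<le> inar_beta \<alpha> k * (1 / (1 - K))"
      by (intro mult_left_mono inar_beta_nonneg)
  qed (auto simp: sum_distrib_left intro!: summable_sum summable_inar_gamma summable_mult2
         summable_divide summable_inar_beta)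
  also have "\<dots> = (\<Sum>k. inar_beta \<alpha> k) * (1 / (1 - K))"
    by (rule suminf_mult2[symmetric, OF summable_inar_beta])
  also have "\<dots> \<le> 1 / (1 - K) * (1 / (1 - K))"
    using K_less by (intro mult_right_mono suminf_inar_beta_le) auto
  finally show ?thesis
    by (simp add: power2_eq_square)
qed

lemma inar_gamma_le: "inar_gamma \<alpha> j \<le> 1 / (1 - K)\<^sup>2"
  using sum_inar_gamma_le[of "Suc j"] sum_nonneg[of "{..<j}" "inar_gamma \<alpha>"] inar_gamma_nonneg
  by fastforce

lemma inar_gamma_yule_walker:
  "inar_gamma \<alpha> j = (if j = 0 then 1 else 0)
     + (\<Sum>k. \<alpha> (Suc k) * inar_gamma \<alpha> (nat \<bar>int j - int (Suc k)\<bar>))"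
proof -
  \<comment> \<open>Extending beta by zero to negative indices turns both the recursion and the
    correlations into unrestricted convolutions over the integers.\<close>
  define b where "b i = (if i < 0 then 0 else inar_beta \<alpha> (nat i))" for i :: int
  define B where "B = 1 / (1 - K)"
  have b_nonneg: "b i \<ge> 0" for i
    by (simp add: b_def inar_beta_nonneg)
  have b_le: "b i \<le> B" for i
    using inar_beta_le K_less by (auto simp: b_def B_def)
  have b_eq_0: "b i = 0" if "i \<notin> range int" for i
    using that by (cases "i < 0") (auto simp: b_def image_iff dest: spec[of _ "nat i"])
  have b_nat: "(\<Sum>\<^sub>\<infinity>i. b i * f i) = (\<Sum>\<^sub>\<infinity>i. inar_beta \<alpha> i * f (int i))" for f
  proof -
    have "(\<Sum>\<^sub>\<infinity>i. b i * f i) = (\<Sum>\<^sub>\<infinity>i\<in>range int. b i * f i)"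
      by (rule infsum_cong_neutral) (auto simp: b_eq_0)
    also have "\<dots> = (\<Sum>\<^sub>\<infinity>i. inar_beta \<alpha> i * f (int i))"
      by (subst infsum_reindex) (auto simp: o_def b_def)
    finally show ?thesis .
  qed
  have b_summable: "b summable_on UNIV"
  proof -
    have "b summable_on range int"
      by (subst summable_on_reindex)
         (auto simp: o_def b_def intro!: summable_nonneg_imp_summable_on summable_inar_beta inar_beta_nonneg)
    then show ?thesis
      by (rule summable_on_cong_neutral[THEN iffD1, rotated -1])
         (auto simp: b_eq_0)
  qed
  define c where "c h = (\<Sum>\<^sub>\<infinity>i. b i * b (i + h))" for h
  have c_nat: "c (int m) = inar_gamma \<alpha> m" for m
  proof -
    have "c (int m) = (\<Sum>\<^sub>\<infinity>i. inar_beta \<alpha> i * inar_beta \<alpha> (i + m))"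
      unfolding c_def b_nat by (intro infsum_cong) (auto simp: b_def nat_add_distrib)
    also have "\<dots> = inar_gamma \<alpha> m"
      unfolding inar_gamma_def
      by (rule infsumI[OF sums_nonneg_imp_has_sum[OF summable_sums[OF summable_inar_gamma]]])
         (auto intro!: mult_nonneg_nonneg inar_beta_nonneg)
    finally show ?thesis .
  qed
  have c_minus: "c (- h) = c h" for h
    unfolding c_def
    by (rule infsum_reindex_bij_witness[of _ "\<lambda>i. i + h" "\<lambda>i. i - h"]) (auto simp: mult.commute)
  have c: "c h = inar_gamma \<alpha> (nat \<bar>h\<bar>)" for h
    using c_nat[of "nat \<bar>h\<bar>"] c_minus[of h] by (cases "h \<ge> 0") auto
  have a_summable: "(\<lambda>k. \<alpha> (Suc k)) summable_on UNIV"
    by (rule summable_nonneg_imp_summable_on[OF sums_summable[OF sums] nonneg])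
  \<comment> \<open>The correction at h = 0 is there because the value 1 of beta at 0 is an initial
    value and not produced by the convolution.\<close>
  have b_rec: "(\<Sum>\<^sub>\<infinity>k. \<alpha> (Suc k) * b (h - int (Suc k))) = b h - (if h = 0 then 1 else 0)" for h
  proof (cases "h \<ge> 1")
    case True
    define m where "m = nat (h - 1)"
    have h: "h = int (Suc m)" using True by (simp add: m_def)
    have "(\<Sum>\<^sub>\<infinity>k. \<alpha> (Suc k) * b (h - int (Suc k))) = (\<Sum>\<^sub>\<infinity>k\<in>{..m}. \<alpha> (Suc k) * b (h - int (Suc k)))"
      by (rule infsum_cong_neutral) (auto simp: b_def h)
    also have "\<dots> = (\<Sum>k\<le>m. \<alpha> (Suc k) * inar_beta \<alpha> (m - k))"
      by (auto simp: b_def h nat_diff_distrib intro!: sum.cong)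
    also have "\<dots> = b h"
      by (subst inar_beta_Suc[symmetric]) (simp add: b_def h nat_add_distrib)
    finally show ?thesis using True by simp
  next
    case False
    then have "(\<lambda>k. \<alpha> (Suc k) * b (h - int (Suc k))) = (\<lambda>k. 0)"
      by (auto simp: b_def)
    moreover have "b h = (if h = 0 then 1 else 0)"
      using False by (auto simp: b_def)
    ultimately show ?thesis
      by (simp del: infsum_0_simp add: infsum_0)
  qed
  \<comment> \<open>Bounding the shifted factor by \<open>B\<close> leaves a product of two summable
    families, which justifies interchanging the two sums below.\<close>
  have prod_summable: "(\<lambda>(k, i). \<alpha> (Suc k) * (b i * b (i + (int j - int (Suc k))))) summable_on UNIV \<times> UNIV"
  proof (rule summable_on_comparison_test)
    show "(\<lambda>(k, i). \<alpha> (Suc k) * (b i * B)) summable_on UNIV \<times> UNIV"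
    proof (rule summable_on_SigmaI)
      show "((\<lambda>i. case (k, i) of (k, i) \<Rightarrow> \<alpha> (Suc k) * (b i * B)) has_sum \<alpha> (Suc k) * (infsum b UNIV * B)) UNIV" for k
        by (auto intro!: has_sum_cmult_right has_sum_cmult_left has_sum_infsum b_summable)
      show "(\<lambda>k. \<alpha> (Suc k) * (infsum b UNIV * B)) summable_on UNIV"
        by (intro summable_on_cmult_left a_summable)
    qed (use nonneg b_nonneg order_trans[OF b_nonneg b_le[of 0]] in \<open>auto intro!: mult_nonneg_nonneg\<close>)
  qed (auto intro!: mult_left_mono mult_nonneg_nonneg nonneg b_nonneg b_le)
  have "(\<Sum>k. \<alpha> (Suc k) * inar_gamma \<alpha> (nat \<bar>int j - int (Suc k)\<bar>))
      = (\<Sum>\<^sub>\<infinity>k. \<alpha> (Suc k) * c (int j - int (Suc k)))"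
  proof -
    have "(\<lambda>k. \<alpha> (Suc k) * inar_gamma \<alpha> (nat \<bar>int j - int (Suc k)\<bar>)) summable_on UNIV"
      by (rule summable_on_comparison_test[OF summable_on_cmult_left[OF a_summable, of "1 / (1 - K)\<^sup>2"]])
         (auto intro!: mult_left_mono mult_nonneg_nonneg nonneg inar_gamma_le inar_gamma_nonneg
           simp del: of_nat_Suc times_divide_eq_right)
    then show ?thesis
      by (metis (no_types, lifting) ext c has_sum_imp_sums has_sum_infsum sums_unique)
  qed
  also have "\<dots> = (\<Sum>\<^sub>\<infinity>k. \<Sum>\<^sub>\<infinity>i. \<alpha> (Suc k) * (b i * b (i + (int j - int (Suc k)))))"
    unfolding c_def infsum_cmult_right' ..
  also have "\<dots> = (\<Sum>\<^sub>\<infinity>i. \<Sum>\<^sub>\<infinity>k. \<alpha> (Suc k) * (b i * b (i + (int j - int (Suc k)))))"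
    by (rule infsum_swap_banach[OF prod_summable])
  also have "\<dots> = (\<Sum>\<^sub>\<infinity>i. b i * (\<Sum>\<^sub>\<infinity>k. \<alpha> (Suc k) * b ((i + int j) - int (Suc k))))"
    by (simp add: infsum_cmult_right'[symmetric] mult.left_commute algebra_simps)
  also have "\<dots> = (\<Sum>\<^sub>\<infinity>i. b i * b (i + int j) - (if i = - int j then b i else 0))"
    unfolding b_rec by (intro infsum_cong) (auto simp: algebra_simps)
  \<comment> \<open>As \<open>j\<close> is a natural number, \<open>b (- int j)\<close> is 1 for j =
    0 and 0 otherwise: this is the indicator in the claim.\<close>
  also have "\<dots> = c (int j) - b (- int j)"
  proof -
    have 1: "(\<lambda>i. b i * b (i + int j)) summable_on UNIV"
      by (rule summable_on_comparison_test[OF summable_on_cmult_left[OF b_summable, of B]])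
         (auto intro!: mult_left_mono mult_nonneg_nonneg b_nonneg b_le)
    have 2: "((\<lambda>i. if i = - int j then b i else 0) has_sum b (- int j)) UNIV"
      using has_sum_finite_neutralI[of "{- int j}" UNIV "\<lambda>i. if i = - int j then b i else 0"] by simp
    show ?thesis
      unfolding c_def diff_conv_add_uminus
      by (rule infsumI) (intro has_sum_add has_sum_infsum 1 has_sum_uminusI 2)
  qed
  finally show ?thesis
    by (auto simp: c b_def)
qed

end

section \<open>Moments of random sums\<close>

text \<open>Both moments come from (k + 1) p(k + 1) = r p(k) for the Poisson weights p. The rate 0
  is treated apart, since there \<open>pois\<close> is a point mass.\<close>

lemma nn_integral_pois:
  assumes "r \<ge> 0"
  shows "(\<integral>\<^sup>+ k. of_nat k \<partial>pois r) = ennreal r"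
    and "(\<integral>\<^sup>+ k. of_nat k * of_nat k \<partial>pois r) = ennreal r * ennreal r + ennreal r"
proof -
  let ?p = "\<lambda>k. r ^ k / fact k * exp (- r)"
  have nn: "(\<integral>\<^sup>+ k. ennreal (f k) \<partial>pois r) = ennreal s"
    if "r \<noteq> 0" "\<And>k. f k \<ge> 0" "(\<lambda>k. ?p k * f k) sums s" for f s
  proof -
    have "(\<integral>\<^sup>+ k. ennreal (f k) \<partial>pois r) = (\<Sum>k. ennreal (?p k * f k))"
      using that(1,2) assms
      by (simp add: pois_def nn_integral_measure_pmf nn_integral_count_space_nat flip: ennreal_mult)
    also have "\<dots> = ennreal s"
      by (rule suminf_ennreal_eq[OF _ that(3)]) (use assms that(2) in auto)
    finally show ?thesis .
  qed
  have "(\<lambda>k. r ^ k / fact k) sums exp r"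
    using exp_converges[of r] by (simp add: divide_inverse mult.commute scaleR_conv_of_real)
  then have "(\<lambda>k. ?p k) sums (exp r * exp (- r))"
    by (rule sums_mult2)
  then have s0: "(\<lambda>k. ?p k) sums 1"
    by (simp add: exp_minus)
  \<comment> \<open>The summands of both moments vanish at 0, so the series may start at 1, where
    the identity for the weights applies.\<close>
  have shift: "f sums s" if "(\<lambda>k. f (Suc k)) sums s" "f 0 = 0" for f :: "nat \<Rightarrow> real" and s
    using that sums_Suc_iff[of f s] by simp
  have Suc: "?p (Suc k) * real (Suc k) = r * ?p k" for k
    by (simp add: fact_Suc divide_simps del: of_nat_Suc)
  have s1: "(\<lambda>k. ?p k * real k) sums r"
    by (rule shift) (use sums_mult[OF s0, of r] in \<open>simp_all only: Suc, simp_all\<close>)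
  have Suc2: "?p (Suc k) * (real (Suc k) * real (Suc k)) = r * (?p k * real k + ?p k)" for k
  proof -
    have "?p (Suc k) * (real (Suc k) * real (Suc k)) = (?p (Suc k) * real (Suc k)) * real (Suc k)"
      by (simp only: mult.assoc)
    also have "\<dots> = r * (?p k * real k + ?p k)"
      unfolding Suc by (simp add: algebra_simps add_divide_distrib)
    finally show ?thesis .
  qed
  have s2: "(\<lambda>k. ?p k * (real k * real k)) sums (r * (r + 1))"
    by (rule shift, simp only: Suc2 sums_mult[OF sums_add[OF s1 s0]]) simp
  show "(\<integral>\<^sup>+ k. of_nat k \<partial>pois r) = ennreal r"
    using nn[OF _ _ s1] by (cases "r = 0") (auto simp: pois_def ennreal_of_nat_eq_real_of_nat)
  show "(\<integral>\<^sup>+ k. of_nat k * of_nat k \<partial>pois r) = ennreal r * ennreal r + ennreal r"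
    using nn[OF _ _ s2] assms
    by (cases "r = 0")
       (auto simp: pois_def ennreal_of_nat_eq_real_of_nat algebra_simps
          simp flip: ennreal_mult ennreal_plus)
qed

text \<open>Wald's identity with fixed summation range: \<open>U i\<close> will be the indicator
  that potential individual \<open>i\<close> exists, \<open>Z i\<close> its offspring count with
  mean \<open>a i\<close>, and \<open>V\<close> a weight known from the past.\<close>

lemma nn_integral_wald:
  fixes U Z :: "nat \<Rightarrow> 'a \<Rightarrow> ennreal"
  assumes [measurable]: "V \<in> borel_measurable M" "\<And>i. U i \<in> borel_measurable M" "\<And>i. Z i \<in> borel_measurable M"
    and eq: "\<And>i. (\<integral>\<^sup>+\<omega>. V \<omega> * U i \<omega> * Z i \<omega> \<partial>M) = a i * (\<integral>\<^sup>+\<omega>. V \<omega> * U i \<omega> \<partial>M)"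
  shows "(\<integral>\<^sup>+\<omega>. V \<omega> * (\<Sum>i. U i \<omega> * Z i \<omega>) \<partial>M) = (\<integral>\<^sup>+\<omega>. V \<omega> * (\<Sum>i. a i * U i \<omega>) \<partial>M)"
proof -
  have "(\<integral>\<^sup>+\<omega>. V \<omega> * (\<Sum>i. U i \<omega> * Z i \<omega>) \<partial>M) = (\<Sum>i. \<integral>\<^sup>+\<omega>. V \<omega> * U i \<omega> * Z i \<omega> \<partial>M)"
    by (simp add: nn_integral_suminf mult.assoc flip: ennreal_suminf_cmult)
  also have "\<dots> = (\<Sum>i. \<integral>\<^sup>+\<omega>. a i * (V \<omega> * U i \<omega>) \<partial>M)"
    by (simp add: eq nn_integral_cmult)
  also have "\<dots> = (\<integral>\<^sup>+\<omega>. V \<omega> * (\<Sum>i. a i * U i \<omega>) \<partial>M)"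
    by (simp add: nn_integral_suminf mult_ac flip: ennreal_suminf_cmult)
  finally show ?thesis .
qed

lemma nn_integral_suminf_square:
  fixes f :: "nat \<Rightarrow> 'a \<Rightarrow> ennreal"
  assumes [measurable]: "\<And>i. f i \<in> borel_measurable M"
  shows "(\<integral>\<^sup>+\<omega>. (\<Sum>i. f i \<omega>) * (\<Sum>i. f i \<omega>) \<partial>M) = (\<Sum>i. \<Sum>j. \<integral>\<^sup>+\<omega>. f i \<omega> * f j \<omega> \<partial>M)"
  by (simp add: nn_integral_suminf mult.commute flip: ennreal_suminf_cmult ennreal_suminf_multc)

text \<open>The additional \<open>a i\<close> on the diagonal is the Poisson variance. Since
  \<open>U i\<close> is an indicator, the diagonal terms add up to the integral of the intensity
  itself.\<close>

lemma nn_integral_wald_square: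
  fixes U Z :: "nat \<Rightarrow> 'a \<Rightarrow> ennreal"
  assumes [measurable]: "\<And>i. U i \<in> borel_measurable M" "\<And>i. Z i \<in> borel_measurable M"
    and idem: "\<And>i \<omega>. U i \<omega> * U i \<omega> = U i \<omega>"
    and eq: "\<And>i j. (\<integral>\<^sup>+\<omega>. U i \<omega> * U j \<omega> * (Z i \<omega> * Z j \<omega>) \<partial>M)
      = (a i * a j + (if i = j then a i else 0)) * (\<integral>\<^sup>+\<omega>. U i \<omega> * U j \<omega> \<partial>M)"
  shows "(\<integral>\<^sup>+\<omega>. (\<Sum>i. U i \<omega> * Z i \<omega>) * (\<Sum>i. U i \<omega> * Z i \<omega>) \<partial>M)
    = (\<integral>\<^sup>+\<omega>. (\<Sum>i. a i * U i \<omega>) * (\<Sum>i. a i * U i \<omega>) \<partial>M) + (\<integral>\<^sup>+\<omega>. (\<Sum>i. a i * U i \<omega>) \<partial>M)"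
proof -
  have diag: "(\<Sum>j. if i = j then f j else 0) = f i" for f :: "nat \<Rightarrow> ennreal" and i
    using suminf_finite[of "{i}" "\<lambda>j. if i = j then f j else 0"] by auto
  have "(\<integral>\<^sup>+\<omega>. (\<Sum>i. U i \<omega> * Z i \<omega>) * (\<Sum>i. U i \<omega> * Z i \<omega>) \<partial>M)
      = (\<Sum>i. \<Sum>j. \<integral>\<^sup>+\<omega>. U i \<omega> * U j \<omega> * (Z i \<omega> * Z j \<omega>) \<partial>M)"
    by (subst nn_integral_suminf_square) (auto simp: mult_ac)
  also have "\<dots> = (\<Sum>i. \<Sum>j. (\<integral>\<^sup>+\<omega>. (a i * U i \<omega>) * (a j * U j \<omega>) \<partial>M)
      + (if i = j then \<integral>\<^sup>+\<omega>. a j * U j \<omega> \<partial>M else 0))"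
  proof (intro suminf_cong)
    fix i j
    have "(\<integral>\<^sup>+\<omega>. (a i * U i \<omega>) * (a j * U j \<omega>) \<partial>M) = (\<integral>\<^sup>+\<omega>. (a i * a j) * (U i \<omega> * U j \<omega>) \<partial>M)"
      by (simp add: mult_ac)
    also have "\<dots> = a i * a j * (\<integral>\<^sup>+\<omega>. U i \<omega> * U j \<omega> \<partial>M)"
      by (simp add: nn_integral_cmult)
    finally show "(\<integral>\<^sup>+\<omega>. U i \<omega> * U j \<omega> * (Z i \<omega> * Z j \<omega>) \<partial>M) = (\<integral>\<^sup>+\<omega>. (a i * U i \<omega>) * (a j * U j \<omega>) \<partial>M)
      + (if i = j then \<integral>\<^sup>+\<omega>. a j * U j \<omega> \<partial>M else 0)"
      by (simp add: eq idem nn_integral_cmult distrib_right)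
  qed
  also have "\<dots> = (\<Sum>i. \<Sum>j. \<integral>\<^sup>+\<omega>. (a i * U i \<omega>) * (a j * U j \<omega>) \<partial>M) + (\<Sum>i. \<integral>\<^sup>+\<omega>. a i * U i \<omega> \<partial>M)"
    by (simp add: diag flip: suminf_add)
  also have "\<dots> = (\<integral>\<^sup>+\<omega>. (\<Sum>i. a i * U i \<omega>) * (\<Sum>i. a i * U i \<omega>) \<partial>M) + (\<integral>\<^sup>+\<omega>. (\<Sum>i. a i * U i \<omega>) \<partial>M)"
    by (subst nn_integral_suminf_square) (auto simp: nn_integral_suminf)
  finally show ?thesis .
qed

section \<open>Product formulas from independent sigma-algebras\<close>

lemma (in prob_space) indep_var_if_indep_set:
  assumes ind: "indep_set (sets G) (sets F)"
    and sp: "space G = space M" "space F = space M"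
    and f: "f \<in> measurable G S" and g: "g \<in> measurable F T"
  shows "indep_var S f T g"
proof -
  have sub: "sets G \<subseteq> events" "sets F \<subseteq> events"
    using ind by (auto simp: indep_set_def indep_sets_def split: bool.splits)
  have gen: "sigma_sets (space M) {h -` A \<inter> space M | A. A \<in> sets N} \<subseteq> sets H"
    if "h \<in> measurable H N" "space H = space M" for h H N
  proof -
    have "sigma_sets (space H) {h -` A \<inter> space M | A. A \<in> sets N} \<subseteq> sets H"
      using that measurable_sets[OF that(1)] by (intro sets.sigma_sets_subset) auto
    then show ?thesis using that by simp
  qed
  show ?thesis
    unfolding indep_var_eq
  proof (intro conjI)
    show "random_variable S f" "random_variable T g"
      using f g sp sub by (auto simp: measurable_def)
    show "indep_set (sigma_sets (space M) {f -` A \<inter> space M | A. A \<in> sets S})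
       (sigma_sets (space M) {g -` A \<inter> space M | A. A \<in> sets T})"
      using ind gen[OF f sp(1)] gen[OF g sp(2)] unfolding indep_set_def
      by (elim indep_sets_mono_sets) (auto split: bool.splits)
  qed
qed

lemma (in prob_space) indep_var_nn_integral:
  assumes "indep_var borel f borel g"
  shows "(\<integral>\<^sup>+\<omega>. f \<omega> * g \<omega> \<partial>M) = (\<integral>\<^sup>+\<omega>. f \<omega> \<partial>M) * (\<integral>\<^sup>+\<omega>. g \<omega> \<partial>M)"
proof -
  have eq: "(\<lambda>b. case b of True \<Rightarrow> borel | False \<Rightarrow> borel) = (\<lambda>_. borel :: ennreal measure)"
    by (auto split: bool.splits)
  have "(\<integral>\<^sup>+\<omega>. (\<Prod>i\<in>UNIV. case_bool f g i \<omega>) \<partial>M) = (\<Prod>i\<in>UNIV. \<integral>\<^sup>+\<omega>. case_bool f g i \<omega> \<partial>M)"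
    using assms by (intro indep_vars_nn_integral) (auto simp: indep_var_def eq)
  then show ?thesis
    by (simp add: UNIV_bool mult.commute)
qed

section \<open>Moments of the offspring sums\<close>

text \<open>Only the noise is fixed, so that the results apply to the approximations, to their limit
  and to an arbitrary solution.\<close>

locale inar =
  fixes M :: "'a measure" and \<alpha> :: "nat \<Rightarrow> real"
    and \<epsilon> :: "int \<Rightarrow> 'a \<Rightarrow> nat" and \<xi> :: "int \<Rightarrow> nat \<Rightarrow> nat \<Rightarrow> 'a \<Rightarrow> nat"
  assumes noise: "inar_noise M \<alpha> \<epsilon> \<xi>" and nonneg: "\<And>k. \<alpha> k \<ge> 0"
begin

sublocale prob_space M
  using noise by (simp add: inar_noise_def)

abbreviation noise_var :: "int + int \<times> nat \<times> nat \<Rightarrow> 'a \<Rightarrow> nat" where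
  "noise_var \<equiv> case_sum \<epsilon> (\<lambda>(n, k, l). \<xi> n k l)"

abbreviation noise_index :: "(int + int \<times> nat \<times> nat) set" where
  "noise_index \<equiv> UNIV <+> (UNIV \<times> {1..} \<times> {1..})"

lemma indep_noise: "indep_vars (\<lambda>_. count_space UNIV) noise_var noise_index"
  using noise by (simp add: inar_noise_def)

lemma measurable_noise [measurable (raw)]:
  "i \<in> noise_index \<Longrightarrow> noise_var i \<in> measurable M (count_space UNIV)"
  using indep_noise by (auto simp: indep_vars_def)

lemma distr_noise:
  "i \<in> noise_index \<Longrightarrow> distr M (count_space UNIV) (noise_var i)
     = measure_pmf (pois (case i of Inl n \<Rightarrow> \<alpha> 0 | Inr (n, k, l) \<Rightarrow> \<alpha> k))"
  using noise by (auto simp: inar_noise_def)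

lemma nn_integral_noise:
  assumes i: "i \<in> noise_index" and r: "r = (case i of Inl n \<Rightarrow> \<alpha> 0 | Inr (n, k, l) \<Rightarrow> \<alpha> k)"
  shows "(\<integral>\<^sup>+\<omega>. of_nat (noise_var i \<omega>) \<partial>M) = ennreal r"
    and "(\<integral>\<^sup>+\<omega>. of_nat (noise_var i \<omega>) * of_nat (noise_var i \<omega>) \<partial>M) = ennreal r * ennreal r + ennreal r"
proof -
  have "r \<ge> 0"
    using nonneg by (auto simp: r split: sum.splits)
  moreover have "(\<integral>\<^sup>+\<omega>. f (noise_var i \<omega>) \<partial>M) = (\<integral>\<^sup>+k. f k \<partial>pois r)" for f :: "nat \<Rightarrow> ennreal"
    unfolding r distr_noise[OF i, symmetric]
    by (subst nn_integral_distr) (use measurable_noise[OF i] in auto)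
  note this[of "\<lambda>k. of_nat k"] this[of "\<lambda>k. of_nat k * of_nat k"]
  ultimately show "(\<integral>\<^sup>+\<omega>. of_nat (noise_var i \<omega>) \<partial>M) = ennreal r"
    and "(\<integral>\<^sup>+\<omega>. of_nat (noise_var i \<omega>) * of_nat (noise_var i \<omega>) \<partial>M) = ennreal r * ennreal r + ennreal r"
    using nn_integral_pois by simp_all
qed

lemma nn_integral_noise_mult:
  assumes "i \<in> noise_index" "j \<in> noise_index" "i \<noteq> j"
  shows "(\<integral>\<^sup>+\<omega>. of_nat (noise_var i \<omega>) * of_nat (noise_var j \<omega>) \<partial>M)
    = (\<integral>\<^sup>+\<omega>. of_nat (noise_var i \<omega>) \<partial>M) * (\<integral>\<^sup>+\<omega>. of_nat (noise_var j \<omega>) \<partial>M)"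
proof -
  have "indep_vars (\<lambda>_. count_space UNIV) noise_var {i, j}"
    by (rule indep_vars_subset[OF indep_noise]) (use assms in auto)
  then have "indep_vars (\<lambda>_. borel) (\<lambda>i \<omega>. of_nat (noise_var i \<omega>) :: ennreal) {i, j}"
    by (rule indep_vars_compose2) simp
  from indep_vars_nn_integral[OF _ this] show ?thesis
    using assms(3) by simp
qed

text \<open>\<open>noise_sigma\<close> as a measure space, so that \<open>measurable\<close> can
  refer to it; \<open>past_algebra\<close> plays the same role for
  \<open>past_sigma\<close>.\<close>

definition noise_algebra :: "int \<Rightarrow> 'a measure" where
  "noise_algebra n = vimage_algebra (space M)
     (\<lambda>\<omega>. (\<epsilon> n \<omega>, \<lambda>p\<in>{1..} \<times> {1..}. \<xi> n (fst p) (snd p) \<omega>))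
     (count_space UNIV \<Otimes>\<^sub>M PiM ({1..} \<times> {1..}) (\<lambda>_. count_space UNIV))"

lemma sets_noise_algebra: "sets (noise_algebra n) = noise_sigma M \<epsilon> \<xi> n"
  by (simp add: noise_algebra_def noise_sigma_def)

lemma space_noise_algebra: "space (noise_algebra n) = space M"
  by (simp add: noise_algebra_def)

lemma measurable_noise_algebra:
  shows "\<epsilon> n \<in> measurable (noise_algebra n) (count_space UNIV)"
    and "k \<ge> 1 \<Longrightarrow> l \<ge> 1 \<Longrightarrow> \<xi> n k l \<in> measurable (noise_algebra n) (count_space UNIV)"
proof -
  let ?f = "\<lambda>\<omega>. (\<epsilon> n \<omega>, \<lambda>p\<in>{1..} \<times> {1..}. \<xi> n (fst p) (snd p) \<omega>)"
  let ?N = "count_space UNIV \<Otimes>\<^sub>M PiM ({1..} \<times> {1..}) (\<lambda>_. count_space UNIV) :: (nat \<times> (nat \<times> nat \<Rightarrow> nat)) measure"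
  have f: "?f \<in> measurable (noise_algebra n) ?N"
    unfolding noise_algebra_def
    by (rule measurable_vimage_algebra1) (auto simp: space_pair_measure space_PiM)
  from measurable_compose[OF this measurable_fst]
  show "\<epsilon> n \<in> measurable (noise_algebra n) (count_space UNIV)" by simp
  assume kl: "k \<ge> 1" "l \<ge> 1"
  have "(\<lambda>p. snd p (k, l)) \<in> measurable ?N (count_space UNIV)"
    by (rule measurable_compose[OF measurable_snd measurable_component_singleton]) (use kl in auto)
  from measurable_compose[OF f this]
  show "\<xi> n k l \<in> measurable (noise_algebra n) (count_space UNIV)"
    using kl by simp
qed

text \<open>The counts \<open>x\<close> and the sigma-algebra \<open>F\<close> are arbitrary because
  the lemma serves twice: for the truncated approximations, to bound moments, and for the process
  itself, to obtain exact equations.\<close>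

lemma moments_of_offspring_sum:
  fixes x :: "nat \<Rightarrow> 'a \<Rightarrow> nat" and V :: "'a \<Rightarrow> ennreal"
  assumes ind: "indep_set (noise_sigma M \<epsilon> \<xi> n) (sets F)" and sp: "space F = space M"
    and x: "\<And>k. x k \<in> measurable F (count_space UNIV)"
  defines "S \<equiv> \<lambda>\<omega>. of_nat (\<epsilon> n \<omega>) + (\<Sum>k. of_nat (\<Sum>l = 1..x k \<omega>. \<xi> n (Suc k) l \<omega>)) :: ennreal"
    and "L \<equiv> \<lambda>\<omega>. ennreal (\<alpha> 0) + (\<Sum>k. ennreal (\<alpha> (Suc k)) * of_nat (x k \<omega>))"
  shows "V \<in> borel_measurable F \<Longrightarrow> (\<integral>\<^sup>+\<omega>. V \<omega> * S \<omega> \<partial>M) = (\<integral>\<^sup>+\<omega>. V \<omega> * L \<omega> \<partial>M)"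
    and "(\<integral>\<^sup>+\<omega>. S \<omega> * S \<omega> \<partial>M) = (\<integral>\<^sup>+\<omega>. L \<omega> * L \<omega> \<partial>M) + (\<integral>\<^sup>+\<omega>. L \<omega> \<partial>M)"
proof -
  note x [measurable]
  note measurable_noise_algebra [measurable]
  \<comment> \<open>The immigration is treated as the offspring at lag 0 of a single individual.\<close>
  define y where "y k \<omega> = (case k of 0 \<Rightarrow> 1 | Suc k \<Rightarrow> x k \<omega>)" for k \<omega>
  \<comment> \<open>The indicator of existence absorbs the random upper limit and is measurable with
    respect to \<open>F\<close>.\<close>
  define u where "u k l \<omega> = (if l < y k \<omega> then 1 else 0 :: ennreal)" for k l \<omega>
  \<comment> \<open>Individuals are numbered from 1 in the noise, hence \<open>Suc l\<close>. The
    padding by 0 at lag 0 is matched by rate 0 in \<open>r\<close>, so that the moment formulas hold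
    for all pairs of indices.\<close>
  define z where "z k l \<omega> = (if k = 0 then if l = 0 then \<epsilon> n \<omega> else 0 else \<xi> n k (Suc l) \<omega>)" for k l \<omega>
  define r where "r k l = ennreal (if k = 0 \<and> l \<noteq> 0 then 0 else \<alpha> k)" for k l :: nat
  \<comment> \<open>Pairs of lag and individual are flattened to one index, the form in which the
    Wald identities are stated.\<close>
  define U where "U i = (case prod_decode i of (k, l) \<Rightarrow> u k l)" for i
  define Z where "Z i \<omega> = (case prod_decode i of (k, l) \<Rightarrow> (of_nat (z k l \<omega>) :: ennreal))" for i \<omega>
  define a where "a i = (case prod_decode i of (k, l) \<Rightarrow> r k l)" for i
  have y[measurable]: "y k \<in> measurable F (count_space UNIV)" for k
    unfolding y_def by (cases k) auto
  have U[measurable]: "U i \<in> borel_measurable F" for i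
    unfolding U_def u_def by (auto split: prod.splits)
  have z[measurable]: "z k l \<in> measurable (noise_algebra n) (count_space UNIV)" for k l
    unfolding z_def by (cases "k = 0"; cases "l = 0") auto
  have Z[measurable]: "Z i \<in> borel_measurable (noise_algebra n)" for i
    unfolding Z_def by (auto split: prod.splits)
  have ind': "indep_set (sets (noise_algebra n)) (sets F)"
    using ind by (simp add: sets_noise_algebra)
  have sub: "sets (noise_algebra n) \<subseteq> events" "sets F \<subseteq> events"
    using ind' by (auto simp: indep_set_def indep_sets_def split: bool.splits)
  have fromN: "f \<in> borel_measurable M" if "f \<in> borel_measurable (noise_algebra n)" for f :: "'a \<Rightarrow> ennreal"
    using that sub space_noise_algebra by (auto simp: measurable_def)
  have fromF: "f \<in> borel_measurable M" if "f \<in> borel_measurable F" for f :: "'a \<Rightarrow> ennreal"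
    using that sub sp by (auto simp: measurable_def)
  have split: "(\<integral>\<^sup>+\<omega>. g \<omega> * f \<omega> \<partial>M) = (\<integral>\<^sup>+\<omega>. f \<omega> \<partial>M) * (\<integral>\<^sup>+\<omega>. g \<omega> \<partial>M)"
    if "f \<in> borel_measurable (noise_algebra n)" "g \<in> borel_measurable F" for f g
    using indep_var_nn_integral[OF indep_var_if_indep_set[OF ind' space_noise_algebra sp that]]
    by (simp add: mult.commute)
  define idx where "idx k l = (if k = 0 then Inl n else Inr (n, k, Suc l))" for k l :: nat
  have z_idx: "z k l = noise_var (idx k l)" "idx k l \<in> noise_index"
      "r k l = ennreal (case idx k l of Inl n \<Rightarrow> \<alpha> 0 | Inr (n, k, l) \<Rightarrow> \<alpha> k)"
    if "\<not> (k = 0 \<and> l \<noteq> 0)" for k l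
    using that by (auto simp: z_def idx_def r_def fun_eq_iff)
  have Ez: "(\<integral>\<^sup>+\<omega>. of_nat (z k l \<omega>) \<partial>M) = r k l" for k l
  proof (cases "k = 0 \<and> l \<noteq> 0")
    case True
    then show ?thesis by (simp add: z_def r_def)
  next
    case False
    then show ?thesis
      using z_idx[OF False] nn_integral_noise(1)[of "idx k l"] by simp
  qed
  have Ezz: "(\<integral>\<^sup>+\<omega>. of_nat (z k l \<omega>) * of_nat (z k' l' \<omega>) \<partial>M)
      = r k l * r k' l' + (if (k, l) = (k', l') then r k l else 0)" for k l k' l'
  proof -
    consider "k = 0 \<and> l \<noteq> 0" | "k' = 0 \<and> l' \<noteq> 0" | "\<not> (k = 0 \<and> l \<noteq> 0)" "(k, l) = (k', l')"
      | "\<not> (k = 0 \<and> l \<noteq> 0)" "\<not> (k' = 0 \<and> l' \<noteq> 0)" "(k, l) \<noteq> (k', l')"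
      by blast
    then show ?thesis
    proof cases
      case 3
      then show ?thesis
        using z_idx[OF 3(1)] nn_integral_noise(2)[of "idx k l"] by simp
    next
      case 4
      \<comment> \<open>\<open>idx\<close> sends every pair with k = 0 to the immigration; it
        separates distinct pairs only because the padding is excluded in this case.\<close>
      then have "idx k l \<noteq> idx k' l'"
        by (auto simp: idx_def)
      then show ?thesis
        using 4(3) z_idx[OF 4(1)] z_idx[OF 4(2)] nn_integral_noise_mult[of "idx k l" "idx k' l'"]
          Ez[of k l] Ez[of k' l'] by auto
    qed (auto simp: z_def r_def)
  qed
  have EZ: "(\<integral>\<^sup>+\<omega>. Z i \<omega> \<partial>M) = a i" for i
    using Ez by (auto simp: Z_def a_def split: prod.splits)
  have EZZ: "(\<integral>\<^sup>+\<omega>. Z i \<omega> * Z j \<omega> \<partial>M) = a i * a j + (if i = j then a i else 0)" for i j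
  proof -
    obtain k l k' l' where ij: "i = prod_encode (k, l)" "j = prod_encode (k', l')"
      by (metis prod_decode_inverse surj_pair)
    show ?thesis
      using Ezz[of k l k' l'] by (simp add: ij Z_def a_def)
  qed
  have S: "S \<omega> = (\<Sum>i. U i \<omega> * Z i \<omega>)" for \<omega>
  proof -
    have inner: "(\<Sum>l. u k l \<omega> * of_nat (z k l \<omega>)) = of_nat (\<Sum>l<y k \<omega>. z k l \<omega>)" for k
      by (subst suminf_finite[of "{..<y k \<omega>}"]) (auto simp: u_def)
    have "(\<Sum>i. U i \<omega> * Z i \<omega>) = (\<Sum>i. (\<lambda>(k, l). u k l \<omega> * of_nat (z k l \<omega>)) (prod_decode i))"
      by (intro suminf_cong) (auto simp: U_def Z_def split: prod.splits)
    also have "\<dots> = (\<Sum>k. of_nat (\<Sum>l<y k \<omega>. z k l \<omega>))"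
      by (rule suminf_ennreal_2dimen) (simp add: inner)
    also have "\<dots> = of_nat (\<Sum>l<y 0 \<omega>. z 0 l \<omega>) + (\<Sum>k. of_nat (\<Sum>l<y (Suc k) \<omega>. z (Suc k) l \<omega>))"
      by (subst suminf_offset[of _ 1]) (auto simp: add.commute)
    also have "\<dots> = S \<omega>"
      by (simp add: S_def y_def z_def sum.atLeast1_atMost_eq)
    finally show ?thesis ..
  qed
  have L: "L \<omega> = (\<Sum>i. a i * U i \<omega>)" for \<omega>
  proof -
    have inner: "(\<Sum>l. r k l * u k l \<omega>) = ennreal (\<alpha> k) * of_nat (y k \<omega>)" for k
    proof -
      have "(\<Sum>l. r k l * u k l \<omega>) = (\<Sum>l<y k \<omega>. r k l * u k l \<omega>)"
        by (rule suminf_finite) (auto simp: u_def)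
      also have "\<dots> = (\<Sum>l<y k \<omega>. ennreal (\<alpha> k))"
        by (rule sum.cong) (auto simp: u_def r_def y_def split: nat.splits if_splits)
      finally show ?thesis by (simp add: mult.commute)
    qed
    have "(\<Sum>i. a i * U i \<omega>) = (\<Sum>i. (\<lambda>(k, l). r k l * u k l \<omega>) (prod_decode i))"
      by (intro suminf_cong) (auto simp: U_def a_def split: prod.splits)
    also have "\<dots> = (\<Sum>k. ennreal (\<alpha> k) * of_nat (y k \<omega>))"
      by (rule suminf_ennreal_2dimen) (simp add: inner)
    also have "\<dots> = ennreal (\<alpha> 0) * of_nat (y 0 \<omega>) + (\<Sum>k. ennreal (\<alpha> (Suc k)) * of_nat (y (Suc k) \<omega>))"
      by (subst suminf_offset[of _ 1]) (auto simp: add.commute)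
    also have "\<dots> = L \<omega>"
      by (simp add: L_def y_def)
    finally show ?thesis ..
  qed
  show "(\<integral>\<^sup>+\<omega>. V \<omega> * S \<omega> \<partial>M) = (\<integral>\<^sup>+\<omega>. V \<omega> * L \<omega> \<partial>M)" if V: "V \<in> borel_measurable F"
    unfolding S L
    by (rule nn_integral_wald) (use V in \<open>simp_all add: fromF fromN split EZ\<close>)
  show "(\<integral>\<^sup>+\<omega>. S \<omega> * S \<omega> \<partial>M) = (\<integral>\<^sup>+\<omega>. L \<omega> * L \<omega> \<partial>M) + (\<integral>\<^sup>+\<omega>. L \<omega> \<partial>M)"
    unfolding S L
  proof (rule nn_integral_wald_square)
    show "U i \<omega> * U i \<omega> = U i \<omega>" for i \<omega>
      by (auto simp: U_def u_def split: prod.splits)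
    show "(\<integral>\<^sup>+\<omega>. U i \<omega> * U j \<omega> * (Z i \<omega> * Z j \<omega>) \<partial>M)
      = (a i * a j + (if i = j then a i else 0)) * (\<integral>\<^sup>+\<omega>. U i \<omega> * U j \<omega> \<partial>M)" for i j
      using split[of "\<lambda>\<omega>. Z i \<omega> * Z j \<omega>" "\<lambda>\<omega>. U i \<omega> * U j \<omega>"] by (simp add: EZZ)
  qed (simp_all add: fromF fromN)
qed

end

section \<open>Construction of the minimal solution\<close>

lemma SUP_eventually_const:
  fixes f :: "nat \<Rightarrow> ennreal"
  assumes "incseq f" "eventually (\<lambda>m. f m = c) sequentially"
  shows "(SUP m. f m) = c"
  using LIMSEQ_unique[OF LIMSEQ_SUP[OF assms(1)] tendsto_eventually[OF assms(2)]] .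

lemma (in prob_space) indep_vars_reindex:
  assumes "inj_on h I" and ind: "indep_vars M' X (h ` I)"
  shows "indep_vars (\<lambda>i. M' (h i)) (\<lambda>i. X (h i)) I"
  unfolding indep_vars_def2
proof (intro conjI ballI indep_setsI)
  note X = ind[unfolded indep_vars_def2]
  show "random_variable (M' (h i)) (X (h i))" if "i \<in> I" for i
    using X that by auto
  then show "{X (h i) -` A \<inter> space M |A. A \<in> sets (M' (h i))} \<subseteq> events" if "i \<in> I" for i
    using that by auto
  fix A J assume J: "J \<noteq> {}" "J \<subseteq> I" "finite J"
    and A: "\<forall>j\<in>J. A j \<in> {X (h j) -` A \<inter> space M |A. A \<in> sets (M' (h j))}"
  have inj: "inj_on h J"
    using assms(1) J(2) by (rule inj_on_subset)
  define g where "g = the_inv_into J h"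
  have g: "g (h j) = j" if "j \<in> J" for j
    using inj that by (simp add: g_def the_inv_into_f_f)
  have "prob (\<Inter>i\<in>h ` J. A (g i)) = (\<Prod>i\<in>h ` J. prob (A (g i)))"
    by (rule indep_setsD[OF conjunct2[OF X]]) (use J A g in auto)
  then show "prob (\<Inter> (A ` J)) = (\<Prod>j\<in>J. prob (A j))"
    using inj by (simp add: prod.reindex g image_image cong: image_cong_simp)
qed

text \<open>Cutting the lags off at \<open>m\<close> keeps every approximation finite everywhere and does not change
  their limit. The argument \<open>w\<close> is a realization of the noise: \<open>Inl n\<close> indexes
  \<open>\<epsilon> n\<close> and \<open>Inr (n, k, l)\<close> indexes \<open>\<xi> n k l\<close>.\<close>

primrec inar_approx :: "nat \<Rightarrow> int \<Rightarrow> (int + int \<times> nat \<times> nat \<Rightarrow> nat) \<Rightarrow> nat" where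
  "inar_approx 0 n w = 0"
| "inar_approx (Suc m) n w = w (Inl n)
    + (\<Sum>k<m. \<Sum>l=1..inar_approx m (n - int (Suc k)) w. w (Inr (n, Suc k, l)))"

lemma inar_approx_Suc_le: "inar_approx m n w \<le> inar_approx (Suc m) n w"
proof (induction m arbitrary: n)
  case (Suc m)
  let ?s = "\<lambda>m k. \<Sum>l=1..inar_approx m (n - int (Suc k)) w. w (Inr (n, Suc k, l))"
  have "(\<Sum>k<m. ?s m k) \<le> (\<Sum>k<m. ?s (Suc m) k)"
    using Suc by (intro sum_mono sum_mono2) (auto intro: order_trans simp del: inar_approx.simps)
  also have "\<dots> \<le> (\<Sum>k<Suc m. ?s (Suc m) k)"
    by simp
  finally show ?case
    by (subst (1 2) inar_approx.simps) simp
qed simp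

lemma inar_approx_mono: "m \<le> m' \<Longrightarrow> inar_approx m n w \<le> inar_approx m' n w"
  by (rule lift_Suc_mono_le[of "\<lambda>m. inar_approx m n w", OF inar_approx_Suc_le])

text \<open>If the approximations are unbounded, the value is 0, because enn2real maps \<open>\<infinity>\<close> to 0.\<close>

definition inar_limit :: "int \<Rightarrow> (int + int \<times> nat \<times> nat \<Rightarrow> nat) \<Rightarrow> nat" where
  "inar_limit n w = nat \<lfloor>enn2real (SUP m. of_nat (inar_approx m n w))\<rfloor>"

lemma incseq_inar_approx: "incseq (\<lambda>m. of_nat (inar_approx m n w) :: ennreal)"
  by (intro incseq_SucI of_nat_mono inar_approx_Suc_le)

text \<open>A bounded increasing sequence of naturals is constant from some index on. Attaining the
  limit, rather than approaching it, is what permits passing to the limit in the upper bounds of the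
  sums.\<close>

lemma inar_limit_eventually:
  assumes "(SUP m. of_nat (inar_approx m n w) :: ennreal) < \<top>"
  shows "eventually (\<lambda>m. inar_approx m n w = inar_limit n w) sequentially"
proof -
  obtain N where N: "(SUP m. of_nat (inar_approx m n w) :: ennreal) < of_nat N"
    using ennreal_Ex_less_of_nat[OF assms] by blast
  have N_bound: "inar_approx m n w \<le> N" for m
  proof -
    have "(of_nat (inar_approx m n w) :: ennreal) \<le> (SUP m. of_nat (inar_approx m n w))"
      by (rule SUP_upper) simp
    from order_le_less_trans[OF this N] show ?thesis
      by (simp add: ennreal_of_nat_eq_real_of_nat ennreal_less_iff)
  qed
  have fin: "finite (range (\<lambda>m. inar_approx m n w))"
    using N_bound by (auto intro!: finite_subset[OF _ finite_atMost[of N]])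
  obtain m0 where "Max (range (\<lambda>m. inar_approx m n w)) = inar_approx m0 n w"
    using Max_in[OF fin] by auto
  then have m0: "inar_approx m n w \<le> inar_approx m0 n w" for m
    using Max_ge[OF fin, of "inar_approx m n w"] by simp
  have ev: "eventually (\<lambda>m. inar_approx m n w = inar_approx m0 n w) sequentially"
    unfolding eventually_sequentially
    by (intro exI[of _ m0] allI impI order_antisym m0 inar_approx_mono)
  have "(SUP m. of_nat (inar_approx m n w) :: ennreal) = of_nat (inar_approx m0 n w)"
    by (rule SUP_eventually_const[OF incseq_inar_approx]) (use ev in eventually_elim, simp)
  then have "inar_limit n w = inar_approx m0 n w"
    by (simp add: inar_limit_def ennreal_of_nat_eq_real_of_nat)
  with ev show ?thesis by simp
qed

text \<open>Monotone convergence for series. Finiteness is assumed at all times because the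
  right-hand side refers to every lag.\<close>

lemma inar_limit_recursion:
  assumes fin: "\<And>n. (SUP m. of_nat (inar_approx m n w) :: ennreal) < \<top>"
  shows "of_nat (inar_limit n w) = (of_nat (w (Inl n))
    + (\<Sum>k. of_nat (\<Sum>l=1..inar_limit (n - int (Suc k)) w. w (Inr (n, Suc k, l)))) :: ennreal)"
proof -
  \<comment> \<open>Setting the terms from index \<open>m\<close> on to 0 turns the truncated sum
    into a full series whose terms increase with \<open>m\<close>.\<close>
  define f where "f m k = (if k < m then of_nat (\<Sum>l=1..inar_approx m (n - int (Suc k)) w. w (Inr (n, Suc k, l))) else 0 :: ennreal)"
    for m k
  have incf: "incseq (\<lambda>m. f m k)" for k
    by (auto simp: f_def incseq_def intro!: of_nat_mono sum_mono2 intro: order_trans[OF _ inar_approx_mono])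
  have SUPf: "(SUP m. f m k) = of_nat (\<Sum>l=1..inar_limit (n - int (Suc k)) w. w (Inr (n, Suc k, l)))" for k
    by (rule SUP_eventually_const[OF incf])
       (use inar_limit_eventually[OF fin, of "n - int (Suc k)"] eventually_gt_at_top[of k] in
          eventually_elim, simp add: f_def)
  have step: "of_nat (inar_approx (Suc m) n w) = of_nat (w (Inl n)) + (\<Sum>k. f m k)" for m
  proof -
    have "(\<Sum>k. f m k) = (\<Sum>k<m. f m k)"
      by (rule suminf_finite) (auto simp: f_def)
    then show ?thesis by (simp add: f_def)
  qed
  have "of_nat (inar_limit n w) = (SUP m. of_nat (inar_approx (Suc m) n w) :: ennreal)"
  proof (rule SUP_eventually_const[symmetric])
    show "incseq (\<lambda>m. of_nat (inar_approx (Suc m) n w) :: ennreal)"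
      by (intro incseq_SucI of_nat_mono inar_approx_Suc_le)
    show "eventually (\<lambda>m. of_nat (inar_approx (Suc m) n w) = (of_nat (inar_limit n w) :: ennreal)) sequentially"
      using inar_limit_eventually[OF fin, of n, THEN sequentially_offset, of 1]
      by eventually_elim (simp only: Suc_eq_plus1)
  qed
  also have "\<dots> = (SUP m. of_nat (w (Inl n)) + (\<Sum>k. f m k))"
    by (simp only: step)
  also have "\<dots> = of_nat (w (Inl n)) + (SUP m. \<Sum>k. f m k)"
    using ennreal_SUP_add_left[of UNIV "\<lambda>m. \<Sum>k. f m k" "of_nat (w (Inl n))"]
    by (simp only: add.commute[of "of_nat (w (Inl n))"] UNIV_not_empty simp_thms)
  also have "(SUP m. \<Sum>k. f m k) = (\<Sum>k. SUP m. f m k)"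
    by (rule ennreal_suminf_SUP_eq[symmetric, OF incf])
  finally show ?thesis
    by (simp only: SUPf)
qed

section \<open>Causality, time shift and measurability of the minimal solution\<close>

definition noise_time :: "int + int \<times> nat \<times> nat \<Rightarrow> int" where
  "noise_time = case_sum (\<lambda>n. n) fst"

text \<open>Causality: unrolling the recursion at time \<open>n\<close> never reaches noise later
  than \<open>n\<close>, nor the unconstrained variables with index k = 0 or l = 0.\<close>

lemma inar_approx_cong:
  assumes "\<And>i. i \<in> UNIV <+> UNIV \<times> {1..} \<times> {1..} \<Longrightarrow> noise_time i \<le> n \<Longrightarrow> w i = w' i"
  shows "inar_approx m n w = inar_approx m n w'"
  using assms
proof (induction m arbitrary: n)
  case (Suc m)
  have "inar_approx m (n - int (Suc k)) w = inar_approx m (n - int (Suc k)) w'" for k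
    by (rule Suc.IH) (use Suc.prems in auto)
  moreover have "w (Inl n) = w' (Inl n)" "l \<ge> 1 \<Longrightarrow> w (Inr (n, Suc k, l)) = w' (Inr (n, Suc k, l))" for k l
    using Suc.prems[of "Inl n"] Suc.prems[of "Inr (n, Suc k, l)"] by (simp_all add: noise_time_def InlI InrI)
  ultimately show ?case
    by simp
qed simp

lemma inar_limit_cong:
  assumes "\<And>i. i \<in> UNIV <+> UNIV \<times> {1..} \<times> {1..} \<Longrightarrow> noise_time i \<le> n \<Longrightarrow> w i = w' i"
  shows "inar_limit n w = inar_limit n w'"
  unfolding inar_limit_def by (simp only: inar_approx_cong[OF assms])

definition noise_shift :: "int \<Rightarrow> int + int \<times> nat \<times> nat \<Rightarrow> int + int \<times> nat \<times> nat" where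
  "noise_shift h = map_sum (\<lambda>n. n + h) (map_prod (\<lambda>n. n + h) id)"

text \<open>The recursion has the same form at every time, so shifting the process amounts to
  shifting the noise; stationarity rests on this.\<close>

lemma inar_approx_shift: "inar_approx m (n + h) w = inar_approx m n (w \<circ> noise_shift h)"
proof (induction m arbitrary: n)
  case (Suc m)
  have "n + h - int (Suc k) = n - int (Suc k) + h" for k
    by simp
  then show ?case
    by (simp only: inar_approx.simps Suc) (simp add: noise_shift_def o_def)
qed simp

lemma inar_limit_shift: "inar_limit (n + h) w = inar_limit n (w \<circ> noise_shift h)"
  by (simp add: inar_limit_def inar_approx_shift)

lemma measurable_nat_borel: "measurable N (borel :: nat measure) = measurable N (count_space UNIV)"
  by (rule measurable_cong_sets) (simp_all add: sets_borel_eq_count_space)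

text \<open>\<open>A\<close> is kept general: the full index set yields random variables, the
  indices before a given time yield independence from the noise at that time.\<close>

lemma measurable_inar_approx:
  assumes "\<And>i. i \<in> UNIV <+> UNIV \<times> {1..} \<times> {1..} \<Longrightarrow> noise_time i \<le> n \<Longrightarrow> i \<in> A"
  shows "inar_approx m n \<in> measurable (PiM A (\<lambda>_. count_space UNIV)) (count_space UNIV)"
  using assms
proof (induction m arbitrary: n)
  case (Suc m)
  let ?P = "PiM A (\<lambda>_. count_space UNIV :: nat measure)"
  have comp: "(\<lambda>w. w i) \<in> measurable ?P borel" if "i \<in> A" for i
    unfolding measurable_nat_borel using that by (rule measurable_component_singleton)
  have 1: "(\<lambda>w. w (Inl n)) \<in> measurable ?P borel"
    by (rule comp, rule Suc.prems) (auto simp: noise_time_def)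
  have 2: "(\<lambda>w. \<Sum>l=1..inar_approx m (n - int (Suc k)) w. w (Inr (n, Suc k, l))) \<in> measurable ?P borel" for k
  \<comment> \<open>The random upper limit has countably many values, so it suffices to treat each
    fixed limit \<open>N\<close>.\<close>
  proof (rule measurable_compose_countable[where f = "\<lambda>N w. \<Sum>l=1..N. w (Inr (n, Suc k, l))"])
    show "(\<lambda>w. \<Sum>l=1..N. w (Inr (n, Suc k, l))) \<in> measurable ?P borel" for N
      by (intro borel_measurable_sum comp Suc.prems) (auto simp: noise_time_def)
    show "inar_approx m (n - int (Suc k)) \<in> measurable ?P (count_space UNIV)"
      by (rule Suc.IH) (use Suc.prems in auto)
  qed
  have "inar_approx (Suc m) n \<in> measurable ?P borel"
    unfolding inar_approx.simps
    by (intro borel_measurable_add borel_measurable_sum 1 2)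
  then show ?case
    by (simp only: measurable_nat_borel)
next
  case 0
  have "inar_approx 0 n = (\<lambda>_. 0)"
    by auto
  then show ?case
    by simp
qed

lemma measurable_inar_limit:
  assumes "\<And>i. i \<in> UNIV <+> UNIV \<times> {1..} \<times> {1..} \<Longrightarrow> noise_time i \<le> n \<Longrightarrow> i \<in> A"
  shows "inar_limit n \<in> measurable (PiM A (\<lambda>_. count_space UNIV)) (count_space UNIV)"
proof -
  note measurable_inar_approx[OF assms, measurable (raw)]
  show ?thesis
    unfolding inar_limit_def by measurable
qed

section \<open>Independence and stationarity of the minimal solution\<close>

definition past_algebra :: "'a measure \<Rightarrow> (int \<Rightarrow> 'a \<Rightarrow> nat) \<Rightarrow> int \<Rightarrow> 'a measure" where
  "past_algebra M X n = vimage_algebra (space M)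
     (\<lambda>\<omega>. \<lambda>m\<in>{..<n}. X m \<omega>) (PiM {..<n} (\<lambda>_. count_space UNIV))"

lemma sets_past_algebra: "sets (past_algebra M X n) = past_sigma M X n"
  by (simp add: past_algebra_def past_sigma_def)

lemma space_past_algebra [simp]: "space (past_algebra M X n) = space M"
  by (simp add: past_algebra_def)

lemma measurable_past_algebra:
  assumes "m < n"
  shows "X m \<in> measurable (past_algebra M X n) (count_space UNIV)"
proof -
  have "(\<lambda>\<omega>. \<lambda>m\<in>{..<n}. X m \<omega>) \<in> measurable (past_algebra M X n) (PiM {..<n} (\<lambda>_. count_space UNIV))"
    unfolding past_algebra_def by (rule measurable_vimage_algebra1) (auto simp: space_PiM)
  from measurable_compose[OF this measurable_component_singleton, of m]
  show ?thesis using assms by simp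
qed

text \<open>From 2 f g \<le> f^2 + g^2; with a common bound \<open>s\<close> this replaces the
  Cauchy-Schwarz inequality and avoids square roots in ennreal.\<close>

lemma nn_integral_of_nat_mult_le:
  fixes f g :: "'a \<Rightarrow> nat"
  assumes [measurable]: "f \<in> measurable M (count_space UNIV)" "g \<in> measurable M (count_space UNIV)"
    and f: "(\<integral>\<^sup>+\<omega>. of_nat (f \<omega>) * of_nat (f \<omega>) \<partial>M) \<le> s"
    and g: "(\<integral>\<^sup>+\<omega>. of_nat (g \<omega>) * of_nat (g \<omega>) \<partial>M) \<le> s"
  shows "(\<integral>\<^sup>+\<omega>. of_nat (f \<omega>) * of_nat (g \<omega>) \<partial>M) \<le> s"
proof -
  have "2 * (of_nat (f \<omega>) * of_nat (g \<omega>) :: ennreal)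
      \<le> of_nat (f \<omega>) * of_nat (f \<omega>) + of_nat (g \<omega>) * of_nat (g \<omega>)" for \<omega>
  proof -
    have "2 * (real (f \<omega>) * real (g \<omega>)) \<le> real (f \<omega>) * real (f \<omega>) + real (g \<omega>) * real (g \<omega>)"
      using sum_squares_bound[of "real (f \<omega>)" "real (g \<omega>)"] by (simp add: power2_eq_square)
    then have "2 * (f \<omega> * g \<omega>) \<le> f \<omega> * f \<omega> + g \<omega> * g \<omega>"
      by (subst of_nat_le_iff[where 'a = real, symmetric]) simp
    then have "of_nat (2 * (f \<omega> * g \<omega>)) \<le> (of_nat (f \<omega> * f \<omega> + g \<omega> * g \<omega>) :: ennreal)"
      by (rule of_nat_mono)
    then show ?thesis by simp
  qed
  then have "(\<integral>\<^sup>+\<omega>. 2 * (of_nat (f \<omega>) * of_nat (g \<omega>)) \<partial>M)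
      \<le> (\<integral>\<^sup>+\<omega>. of_nat (f \<omega>) * of_nat (f \<omega>) + of_nat (g \<omega>) * of_nat (g \<omega>) \<partial>M)"
    by (intro nn_integral_mono)
  then have "2 * (\<integral>\<^sup>+\<omega>. of_nat (f \<omega>) * of_nat (g \<omega>) \<partial>M) \<le> s + s"
    using add_mono[OF f g] by (simp add: nn_integral_cmult nn_integral_add)
  then show ?thesis
    by (simp add: mult_2[symmetric] ennreal_mult_le_mult_iff)
qed

lemma (in prob_space) indep_set_vimage_algebra_compose:
  assumes ind: "indep_var S X T Y"
    and G: "G \<in> measurable S S'" and H: "H \<in> measurable T T'"
  shows "indep_set (sets (vimage_algebra (space M) (\<lambda>\<omega>. G (X \<omega>)) S'))
    (sets (vimage_algebra (space M) (\<lambda>\<omega>. H (Y \<omega>)) T'))"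
proof -
  let ?X = "vimage_algebra (space M) X S" and ?Y = "vimage_algebra (space M) Y T"
  have rv: "random_variable S X" "random_variable T Y"
    using ind by (simp_all add: indep_var_eq)
  have XY: "X \<in> measurable ?X S" "Y \<in> measurable ?Y T"
    using rv by (auto intro!: measurable_vimage_algebra1 dest: measurable_space)
  have "sets (vimage_algebra (space M) (\<lambda>\<omega>. G (X \<omega>)) S') \<subseteq> sets ?X"
    using sets_image_in_sets[OF _ measurable_compose[OF XY(1) G]] by simp
  moreover have "sets (vimage_algebra (space M) (\<lambda>\<omega>. H (Y \<omega>)) T') \<subseteq> sets ?Y"
    using sets_image_in_sets[OF _ measurable_compose[OF XY(2) H]] by simp
  moreover have "indep_set (sets ?X) (sets ?Y)"
    using ind by (simp add: indep_var_eq sets_vimage_algebra)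
  ultimately show ?thesis
    unfolding indep_set_def by (elim indep_sets_mono_sets) (auto split: bool.splits)
qed

context inar
begin

text \<open>Noise at time \<open>n\<close> and noise before \<open>n\<close> are disjoint parts of
  one independent family, and by causality the past of \<open>Y\<close> is a function of the
  latter.\<close>

lemma indep_noise_past:
  assumes f: "\<And>m. m < n \<Longrightarrow> f m \<in> measurable
      (PiM {i \<in> noise_index. noise_time i < n} (\<lambda>_. count_space UNIV)) (count_space UNIV)"
    and Y: "\<And>m \<omega>. m < n \<Longrightarrow> Y m \<omega> = f m (\<lambda>i\<in>{i \<in> noise_index. noise_time i < n}. noise_var i \<omega>)"
  shows "indep_set (noise_sigma M \<epsilon> \<xi> n) (past_sigma M Y n)"
proof -
  let ?A = "{i \<in> noise_index. noise_time i = n}" and ?B = "{i \<in> noise_index. noise_time i < n}"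
  let ?PA = "PiM ?A (\<lambda>_. count_space UNIV :: nat measure)" and ?PB = "PiM ?B (\<lambda>_. count_space UNIV :: nat measure)"
  let ?G = "\<lambda>w. (w (Inl n), \<lambda>p\<in>{1..} \<times> {1..}. w (Inr (n, fst p, snd p))) :: nat \<times> (nat \<times> nat \<Rightarrow> nat)"
  let ?F = "\<lambda>w. \<lambda>m\<in>{..<n}. f m w"
  have ind: "indep_var ?PA (\<lambda>\<omega>. \<lambda>i\<in>?A. noise_var i \<omega>) ?PB (\<lambda>\<omega>. \<lambda>i\<in>?B. noise_var i \<omega>)"
    by (rule indep_var_restrict[OF indep_noise]) auto
  have G: "?G \<in> measurable ?PA (count_space UNIV \<Otimes>\<^sub>M PiM ({1..} \<times> {1..}) (\<lambda>_. count_space UNIV))"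
    by (intro measurable_Pair measurable_restrict measurable_component_singleton)
       (auto simp: noise_time_def)
  have F: "?F \<in> measurable ?PB (PiM {..<n} (\<lambda>_. count_space UNIV))"
    by (intro measurable_restrict f) auto
  have "(\<lambda>\<omega>. ?G (\<lambda>i\<in>?A. noise_var i \<omega>)) = (\<lambda>\<omega>. (\<epsilon> n \<omega>, \<lambda>p\<in>{1..} \<times> {1..}. \<xi> n (fst p) (snd p) \<omega>))"
    by (auto simp: fun_eq_iff noise_time_def restrict_def)
  moreover have "(\<lambda>\<omega>. ?F (\<lambda>i\<in>?B. noise_var i \<omega>)) = (\<lambda>\<omega>. \<lambda>m\<in>{..<n}. Y m \<omega>)"
    by (auto simp: fun_eq_iff Y restrict_def)
  ultimately show ?thesis
    using indep_set_vimage_algebra_compose[OF ind G F]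
    unfolding noise_sigma_def past_sigma_def by (simp only:)
qed

definition approx :: "nat \<Rightarrow> int \<Rightarrow> 'a \<Rightarrow> nat" where
  "approx m n \<omega> = inar_approx m n (\<lambda>i. noise_var i \<omega>)"

definition limit :: "int \<Rightarrow> 'a \<Rightarrow> nat" where
  "limit n \<omega> = inar_limit n (\<lambda>i. noise_var i \<omega>)"

lemma measurable_noise_restrict:
  "(\<lambda>\<omega>. \<lambda>i\<in>noise_index. noise_var i \<omega>) \<in> measurable M (PiM noise_index (\<lambda>_. count_space UNIV))"
  by (intro measurable_restrict measurable_noise)

lemma approx_restrict:
  "(\<And>i. i \<in> noise_index \<Longrightarrow> noise_time i \<le> n \<Longrightarrow> i \<in> A) \<Longrightarrow>
    approx m n \<omega> = inar_approx m n (\<lambda>i\<in>A. noise_var i \<omega>)"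
  unfolding approx_def by (rule inar_approx_cong) auto

lemma limit_restrict:
  "(\<And>i. i \<in> noise_index \<Longrightarrow> noise_time i \<le> n \<Longrightarrow> i \<in> A) \<Longrightarrow>
    limit n \<omega> = inar_limit n (\<lambda>i\<in>A. noise_var i \<omega>)"
  unfolding limit_def by (rule inar_limit_cong) auto

lemma measurable_approx [measurable]: "approx m n \<in> measurable M (count_space UNIV)"
proof -
  have "approx m n = (\<lambda>\<omega>. inar_approx m n (\<lambda>i\<in>noise_index. noise_var i \<omega>))"
    by (intro ext approx_restrict)
  then show ?thesis
    by (simp only:) (rule measurable_compose[OF measurable_noise_restrict measurable_inar_approx])
qed

lemma measurable_limit [measurable]: "limit n \<in> measurable M (count_space UNIV)"
proof -
  have "limit n = (\<lambda>\<omega>. inar_limit n (\<lambda>i\<in>noise_index. noise_var i \<omega>))"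
    by (intro ext limit_restrict)
  then show ?thesis
    by (simp only:) (rule measurable_compose[OF measurable_noise_restrict measurable_inar_limit])
qed

lemma indep_noise_past_approx: "indep_set (noise_sigma M \<epsilon> \<xi> n) (past_sigma M (approx m) n)"
  by (rule indep_noise_past[where f = "inar_approx m"])
     (auto intro!: measurable_inar_approx approx_restrict simp del: One_nat_def)

lemma indep_noise_past_limit: "indep_set (noise_sigma M \<epsilon> \<xi> n) (past_sigma M limit n)"
  by (rule indep_noise_past[where f = inar_limit])
     (auto intro!: measurable_inar_limit limit_restrict simp del: One_nat_def)

text \<open>The shifted limit is the same functional of the shifted noise, and the latter has the
  same product law because the rates depend on the lag but not on the time.\<close>

lemma strictly_stationary_limit: "strictly_stationary M limit"
  unfolding strictly_stationary_def
proof
  fix h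
  let ?P = "PiM noise_index (\<lambda>_. count_space UNIV :: nat measure)"
  let ?Q = "PiM UNIV (\<lambda>_. count_space UNIV) :: (int \<Rightarrow> nat) measure"
  define W where "W h \<omega> = (\<lambda>i\<in>noise_index. noise_var (noise_shift h i) \<omega>)" for h \<omega>
  have shift_index: "noise_shift h i \<in> noise_index" if "i \<in> noise_index" for h i
    using that by (auto simp: noise_shift_def)
  have W: "W h \<in> measurable M ?P" for h
    unfolding W_def by (intro measurable_restrict measurable_noise shift_index)
  have "inj (noise_shift h)" for h
    unfolding noise_shift_def
    by (intro sum.inj_map prod.inj_map) (auto simp: inj_on_def)
  then have "inj_on (noise_shift h) noise_index" for h
    by (rule inj_on_subset) simp
  then have "indep_vars (\<lambda>_. count_space UNIV) (\<lambda>i. noise_var (noise_shift h i)) noise_index" for h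
    by (rule indep_vars_reindex[where M' = "\<lambda>_. count_space UNIV"])
       (rule indep_vars_subset[OF indep_noise image_subsetI[OF shift_index]])
  then have "distr M ?P (W h) = PiM noise_index (\<lambda>i. distr M (count_space UNIV) (noise_var (noise_shift h i)))" for h
    unfolding W_def
    by (rule indep_vars_iff_distr_eq_PiM'[THEN iffD1, rotated 2]) (auto intro!: measurable_noise shift_index simp del: One_nat_def)
  also have "PiM noise_index (\<lambda>i. distr M (count_space UNIV) (noise_var (noise_shift h i)))
      = PiM noise_index (\<lambda>i. distr M (count_space UNIV) (noise_var i))" for h
  proof (rule PiM_cong)
    fix i assume i: "i \<in> noise_index"
    show "distr M (count_space UNIV) (noise_var (noise_shift h i)) = distr M (count_space UNIV) (noise_var i)"
      unfolding distr_noise[OF i] distr_noise[OF shift_index[OF i]]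
      by (auto simp: noise_shift_def split: sum.splits)
  qed simp
  finally have distr_W: "distr M ?P (W h) = PiM noise_index (\<lambda>i. distr M (count_space UNIV) (noise_var i))" for h .
  let ?L = "\<lambda>w n. inar_limit n w"
  have L: "?L \<in> measurable ?P ?Q"
    by (rule measurable_PiM_single') (auto intro!: measurable_inar_limit simp del: One_nat_def)
  have eq: "(\<lambda>\<omega> n. limit (n + h) \<omega>) = ?L \<circ> W h" for h
    by (auto simp: fun_eq_iff limit_def inar_limit_shift W_def intro!: inar_limit_cong)
  have "distr M ?Q (\<lambda>\<omega> n. limit (n + h) \<omega>) = distr (distr M ?P (W h)) ?Q ?L" for h
    unfolding eq by (rule distr_distr[symmetric, OF L W])
  then have "distr M ?Q (\<lambda>\<omega> n. limit (n + h) \<omega>) = distr M ?Q (\<lambda>\<omega> n. limit (n + 0) \<omega>)"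
    by (simp only: distr_W)
  then show "distr M ?Q (\<lambda>\<omega> n. limit (n + h) \<omega>) = distr M ?Q (\<lambda>\<omega> n. limit n \<omega>)"
    by simp
qed

end

section \<open>Moment bounds for the minimal solution\<close>

locale subcritical_inar = inar +
  fixes K :: real
  assumes sums_alpha: "(\<lambda>k. \<alpha> (Suc k)) sums K" and K_less: "K < 1"
begin

lemma K_nonneg: "K \<ge> 0"
  using sums_le[OF nonneg sums_zero sums_alpha] by simp

lemma suminf_alpha: "(\<Sum>k. ennreal (\<alpha> (Suc k))) = ennreal K"
  by (rule suminf_ennreal_eq[OF nonneg sums_alpha])

definition \<mu> :: real where "\<mu> = \<alpha> 0 / (1 - K)"

lemma mu_nonneg: "\<mu> \<ge> 0"
  using nonneg K_less by (simp add: \<mu>_def)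

lemma mu_eq: "\<alpha> 0 + K * \<mu> = \<mu>"
  using K_less by (simp add: \<mu>_def field_simps)

text \<open>The fixed point of the upper bound on the second moment of one approximation in terms of that of
  the previous one.\<close>

definition \<sigma> :: real where "\<sigma> = (\<alpha> 0 * \<alpha> 0 + 2 * (\<alpha> 0 * (K * \<mu>)) + \<mu>) / (1 - K * K)"

lemma K_square_less: "K * K < 1"
  using mult_strict_mono[of K 1 K 1] K_less K_nonneg by simp

lemma sigma_nonneg: "\<sigma> \<ge> 0"
  unfolding \<sigma>_def
  by (intro divide_nonneg_nonneg add_nonneg_nonneg mult_nonneg_nonneg nonneg K_nonneg mu_nonneg)
     (use K_square_less in auto)

lemma sigma_eq: "\<alpha> 0 * \<alpha> 0 + 2 * (\<alpha> 0 * (K * \<mu>)) + K * K * \<sigma> + \<mu> = \<sigma>"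
proof -
  have "\<alpha> 0 * \<alpha> 0 + 2 * (\<alpha> 0 * (K * \<mu>)) + \<mu> = \<sigma> * (1 - K * K)"
    using K_square_less by (simp add: \<sigma>_def)
  then show ?thesis by (simp add: algebra_simps)
qed

text \<open>The bounds \<mu> and \<sigma> reproduce themselves. The left-hand side of the second
  conclusion is the second moment of the offspring sum with intensity \<open>L\<close>, by
  \<open>moments_of_offspring_sum\<close>.\<close>

lemma intensity_moments:
  fixes x :: "nat \<Rightarrow> 'a \<Rightarrow> nat"
  assumes [measurable]: "\<And>k. x k \<in> measurable M (count_space UNIV)"
    and mean: "\<And>k. (\<integral>\<^sup>+\<omega>. of_nat (x k \<omega>) \<partial>M) \<le> ennreal \<mu>"
  defines "L \<equiv> \<lambda>\<omega>. ennreal (\<alpha> 0) + (\<Sum>k. ennreal (\<alpha> (Suc k)) * of_nat (x k \<omega>))"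
  shows "(\<integral>\<^sup>+\<omega>. L \<omega> \<partial>M) \<le> ennreal \<mu>"
    and "(\<And>k. (\<integral>\<^sup>+\<omega>. of_nat (x k \<omega>) * of_nat (x k \<omega>) \<partial>M) \<le> ennreal \<sigma>) \<Longrightarrow>
      (\<integral>\<^sup>+\<omega>. L \<omega> * L \<omega> \<partial>M) + (\<integral>\<^sup>+\<omega>. L \<omega> \<partial>M) \<le> ennreal \<sigma>"
proof -
  define a where "a k = ennreal (\<alpha> (Suc k))" for k
  define T where "T \<omega> = (\<Sum>k. a k * of_nat (x k \<omega>))" for \<omega>
  have [measurable]: "T \<in> borel_measurable M"
    unfolding T_def by measurable
  have L: "L \<omega> = ennreal (\<alpha> 0) + T \<omega>" for \<omega>
    by (simp add: L_def T_def a_def)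
  have "(\<integral>\<^sup>+\<omega>. T \<omega> \<partial>M) = (\<Sum>k. a k * (\<integral>\<^sup>+\<omega>. of_nat (x k \<omega>) \<partial>M))"
    unfolding T_def by (simp add: nn_integral_suminf nn_integral_cmult)
  also have "\<dots> \<le> (\<Sum>k. a k * ennreal \<mu>)"
    by (intro suminf_le mult_left_mono mean) auto
  also have "\<dots> = ennreal (K * \<mu>)"
    using K_nonneg mu_nonneg by (simp add: a_def suminf_alpha ennreal_suminf_multc ennreal_mult)
  finally have T: "(\<integral>\<^sup>+\<omega>. T \<omega> \<partial>M) \<le> ennreal (K * \<mu>)" .
  have "(\<integral>\<^sup>+\<omega>. L \<omega> \<partial>M) = ennreal (\<alpha> 0) + (\<integral>\<^sup>+\<omega>. T \<omega> \<partial>M)"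
    unfolding L by (simp add: nn_integral_add emeasure_space_1)
  also have "\<dots> \<le> ennreal (\<alpha> 0) + ennreal (K * \<mu>)"
    by (rule add_left_mono[OF T])
  also have "\<dots> = ennreal \<mu>"
    using K_nonneg mu_nonneg nonneg mu_eq by (simp flip: ennreal_plus)
  finally show mean_L: "(\<integral>\<^sup>+\<omega>. L \<omega> \<partial>M) \<le> ennreal \<mu>" .
  assume sq: "\<And>k. (\<integral>\<^sup>+\<omega>. of_nat (x k \<omega>) * of_nat (x k \<omega>) \<partial>M) \<le> ennreal \<sigma>"
  have "(\<integral>\<^sup>+\<omega>. T \<omega> * T \<omega> \<partial>M) = (\<Sum>k. \<Sum>l. \<integral>\<^sup>+\<omega>. (a k * of_nat (x k \<omega>)) * (a l * of_nat (x l \<omega>)) \<partial>M)"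
    unfolding T_def by (rule nn_integral_suminf_square) measurable
  also have "\<dots> = (\<Sum>k. \<Sum>l. \<integral>\<^sup>+\<omega>. (a k * a l) * (of_nat (x k \<omega>) * of_nat (x l \<omega>)) \<partial>M)"
    by (simp add: mult_ac)
  also have "\<dots> = (\<Sum>k. \<Sum>l. (a k * a l) * (\<integral>\<^sup>+\<omega>. of_nat (x k \<omega>) * of_nat (x l \<omega>) \<partial>M))"
    by (simp add: nn_integral_cmult)
  also have "\<dots> \<le> (\<Sum>k. \<Sum>l. (a k * a l) * ennreal \<sigma>)"
    \<comment> \<open>Mixed moments are bounded by the same \<sigma> as the squares, so summing the
      weights gives the factor K * K < 1.\<close>
    by (intro suminf_le mult_left_mono nn_integral_of_nat_mult_le[OF assms(1,1) sq sq]) auto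
  also have "\<dots> = ennreal (K * K * \<sigma>)"
    using K_nonneg sigma_nonneg
    by (simp add: a_def suminf_alpha ennreal_suminf_multc ennreal_suminf_cmult ennreal_mult)
  finally have TT: "(\<integral>\<^sup>+\<omega>. T \<omega> * T \<omega> \<partial>M) \<le> ennreal (K * K * \<sigma>)" .
  have "(\<integral>\<^sup>+\<omega>. L \<omega> * L \<omega> \<partial>M)
      = (\<integral>\<^sup>+\<omega>. ennreal (\<alpha> 0) * ennreal (\<alpha> 0) + 2 * ennreal (\<alpha> 0) * T \<omega> + T \<omega> * T \<omega> \<partial>M)"
    unfolding L by (intro nn_integral_cong) (simp only: mult_2 distrib_left distrib_right, simp only: ac_simps)
  also have "\<dots> = ennreal (\<alpha> 0) * ennreal (\<alpha> 0) + 2 * ennreal (\<alpha> 0) * (\<integral>\<^sup>+\<omega>. T \<omega> \<partial>M)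
      + (\<integral>\<^sup>+\<omega>. T \<omega> * T \<omega> \<partial>M)"
    by (simp add: nn_integral_add nn_integral_cmult emeasure_space_1)
  also have "\<dots> \<le> ennreal (\<alpha> 0) * ennreal (\<alpha> 0) + 2 * ennreal (\<alpha> 0) * ennreal (K * \<mu>) + ennreal (K * K * \<sigma>)"
    by (intro add_mono mult_left_mono T TT) auto
  also have "\<dots> = ennreal (\<alpha> 0 * \<alpha> 0 + 2 * (\<alpha> 0 * (K * \<mu>)) + K * K * \<sigma>)"
  proof -
    have "2 * ennreal (\<alpha> 0) = ennreal (2 * \<alpha> 0)"
      using nonneg by (simp add: ennreal_mult)
    then show ?thesis
      using nonneg K_nonneg mu_nonneg sigma_nonneg by (simp add: mult.assoc flip: ennreal_mult ennreal_plus)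
  qed
  finally have "(\<integral>\<^sup>+\<omega>. L \<omega> * L \<omega> \<partial>M) + (\<integral>\<^sup>+\<omega>. L \<omega> \<partial>M)
      \<le> ennreal (\<alpha> 0 * \<alpha> 0 + 2 * (\<alpha> 0 * (K * \<mu>)) + K * K * \<sigma>) + ennreal \<mu>"
    using mean_L by (rule add_mono)
  also have "\<dots> = ennreal \<sigma>"
    using nonneg K_nonneg mu_nonneg sigma_nonneg sigma_eq by (simp flip: ennreal_plus)
  finally show "(\<integral>\<^sup>+\<omega>. L \<omega> * L \<omega> \<partial>M) + (\<integral>\<^sup>+\<omega>. L \<omega> \<partial>M) \<le> ennreal \<sigma>" .
qed

lemma moments_approx:
  "(\<integral>\<^sup>+\<omega>. of_nat (approx m n \<omega>) \<partial>M) \<le> ennreal \<mu> \<and>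
   (\<integral>\<^sup>+\<omega>. of_nat (approx m n \<omega>) * of_nat (approx m n \<omega>) \<partial>M) \<le> ennreal \<sigma>"
proof (induction m arbitrary: n)
  case 0
  show ?case by (simp add: approx_def)
next
  case (Suc m)
  \<comment> \<open>Zero parents from lag m + 1 on bring the truncated recursion into the form of a
    full series.\<close>
  define x where "x k \<omega> = (if k < m then approx m (n - int (Suc k)) \<omega> else 0)" for k \<omega>
  have xM [measurable]: "x k \<in> measurable M (count_space UNIV)" for k
    unfolding x_def by (cases "k < m") auto
  have xF: "x k \<in> measurable (past_algebra M (approx m) n) (count_space UNIV)" for k
    unfolding x_def by (cases "k < m") (auto intro: measurable_past_algebra)
  have x1: "(\<integral>\<^sup>+\<omega>. of_nat (x k \<omega>) \<partial>M) \<le> ennreal \<mu>" for k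
    unfolding x_def using Suc by (cases "k < m") auto
  have x2: "(\<integral>\<^sup>+\<omega>. of_nat (x k \<omega>) * of_nat (x k \<omega>) \<partial>M) \<le> ennreal \<sigma>" for k
    unfolding x_def using Suc by (cases "k < m") auto
  have S: "of_nat (approx (Suc m) n \<omega>)
      = (of_nat (\<epsilon> n \<omega>) + (\<Sum>k. of_nat (\<Sum>l = 1..x k \<omega>. \<xi> n (Suc k) l \<omega>)) :: ennreal)" for \<omega>
  proof -
    have "(\<Sum>k. of_nat (\<Sum>l = 1..x k \<omega>. \<xi> n (Suc k) l \<omega>) :: ennreal)
        = (\<Sum>k<m. of_nat (\<Sum>l = 1..x k \<omega>. \<xi> n (Suc k) l \<omega>))"
      by (rule suminf_finite) (auto simp: x_def)
    then show ?thesis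
      by (simp add: approx_def x_def)
  qed
  have ind: "indep_set (noise_sigma M \<epsilon> \<xi> n) (sets (past_algebra M (approx m) n))"
    unfolding sets_past_algebra by (rule indep_noise_past_approx)
  have "(\<integral>\<^sup>+\<omega>. of_nat (approx (Suc m) n \<omega>) \<partial>M)
      = (\<integral>\<^sup>+\<omega>. ennreal (\<alpha> 0) + (\<Sum>k. ennreal (\<alpha> (Suc k)) * of_nat (x k \<omega>)) \<partial>M)"
    using moments_of_offspring_sum(1)[OF ind space_past_algebra xF, of "\<lambda>_. 1"] by (simp add: S del: of_nat_sum)
  moreover have "(\<integral>\<^sup>+\<omega>. of_nat (approx (Suc m) n \<omega>) * of_nat (approx (Suc m) n \<omega>) \<partial>M)
      \<le> ennreal \<sigma>"
    unfolding S moments_of_offspring_sum(2)[OF ind space_past_algebra xF]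
    by (rule intensity_moments(2)[OF xM x1 x2])
  ultimately show ?case
    using intensity_moments(1)[OF xM x1] by simp
qed

lemma approx_mono: "m \<le> m' \<Longrightarrow> approx m n \<omega> \<le> approx m' n \<omega>"
  unfolding approx_def by (rule inar_approx_mono)

text \<open>By monotone convergence the supremum has mean at most \<mu>, hence is almost surely
  finite; countably many times share one null set.\<close>

lemma AE_SUP_approx_finite: "AE \<omega> in M. \<forall>n. (SUP m. of_nat (approx m n \<omega>) :: ennreal) < \<top>"
  unfolding AE_all_countable
proof
  fix n
  have "(\<integral>\<^sup>+\<omega>. (SUP m. of_nat (approx m n \<omega>)) \<partial>M) = (SUP m. \<integral>\<^sup>+\<omega>. of_nat (approx m n \<omega>) \<partial>M)"
    by (intro nn_integral_monotone_convergence_SUP)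
       (auto simp: incseq_def le_fun_def intro!: of_nat_mono approx_mono)
  also have "\<dots> \<le> ennreal \<mu>"
    by (intro SUP_least) (use moments_approx in auto)
  finally have "(\<integral>\<^sup>+\<omega>. (SUP m. of_nat (approx m n \<omega>)) \<partial>M) \<noteq> \<infinity>"
    using top.not_eq_extremum ennreal_less_top le_less_trans by (metis infinity_ennreal_def)
  from nn_integral_PInf_AE[OF _ this]
  have "AE \<omega> in M. (SUP m. of_nat (approx m n \<omega>) :: ennreal) \<noteq> \<infinity>"
    by measurable
  then show "AE \<omega> in M. (SUP m. of_nat (approx m n \<omega>) :: ennreal) < \<top>"
    by eventually_elim (simp only: infinity_ennreal_def less_top)
qed

lemma square_moment_limit: "(\<integral>\<^sup>+\<omega>. of_nat (limit n \<omega>) * of_nat (limit n \<omega>) \<partial>M) \<le> ennreal \<sigma>"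
proof -
  have "(\<integral>\<^sup>+\<omega>. of_nat (limit n \<omega>) * of_nat (limit n \<omega>) \<partial>M)
      \<le> (\<integral>\<^sup>+\<omega>. (SUP m. of_nat (approx m n \<omega>) * of_nat (approx m n \<omega>)) \<partial>M)"
  proof (rule nn_integral_mono_AE)
    show "AE \<omega> in M. of_nat (limit n \<omega>) * of_nat (limit n \<omega>)
        \<le> (SUP m. of_nat (approx m n \<omega>) * of_nat (approx m n \<omega>) :: ennreal)"
      using AE_SUP_approx_finite
    proof eventually_elim
      case (elim \<omega>)
      then have "\<forall>\<^sub>F m in sequentially. approx m n \<omega> = limit n \<omega>"
        unfolding approx_def limit_def by (intro inar_limit_eventually) auto
      then obtain m where "approx m n \<omega> = limit n \<omega>"
        using eventually_happens trivial_limit_sequentially by blast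
      then show ?case
        by (intro SUP_upper2[of m]) auto
    qed
  qed
  also have "\<dots> = (SUP m. \<integral>\<^sup>+\<omega>. of_nat (approx m n \<omega>) * of_nat (approx m n \<omega>) \<partial>M)"
    by (intro nn_integral_monotone_convergence_SUP)
       (auto simp: incseq_def le_fun_def intro!: mult_mono of_nat_mono approx_mono)
  also have "\<dots> \<le> ennreal \<sigma>"
    by (intro SUP_least) (use moments_approx in auto)
  finally show ?thesis .
qed

text \<open>This supplies the competitor for the uniqueness clause of \<open>inar_process\<close>,
  through which the second moment bound reaches the given process.\<close>

lemma stationary_inar_solution_limit: "stationary_inar_solution M \<epsilon> \<xi> limit"
  unfolding stationary_inar_solution_def
proof (intro conjI allI)
  show "AE \<omega> in M. (of_nat (limit n \<omega>) :: ennreal) = of_nat (\<epsilon> n \<omega>)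
      + (\<Sum>k. of_nat (\<Sum>l = 1..limit (n - int (Suc k)) \<omega>. \<xi> n (Suc k) l \<omega>))" for n
    using AE_SUP_approx_finite
  proof eventually_elim
    case (elim \<omega>)
    have "of_nat (limit n \<omega>) = (of_nat (noise_var (Inl n) \<omega>)
        + (\<Sum>k. of_nat (\<Sum>l = 1..limit (n - int (Suc k)) \<omega>. noise_var (Inr (n, Suc k, l)) \<omega>)) :: ennreal)"
      unfolding limit_def by (rule inar_limit_recursion) (use elim in \<open>simp add: approx_def\<close>)
    then show ?case by simp
  qed
qed (simp_all add: strictly_stationary_limit indep_noise_past_limit)

end

section \<open>The autocovariance function\<close>

lemma nn_integral_strictly_stationary:
  assumes st: "strictly_stationary M X" and X: "\<And>n. X n \<in> measurable M (count_space UNIV)"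
    and g: "g \<in> borel_measurable (PiM UNIV (\<lambda>_. count_space UNIV))"
  shows "(\<integral>\<^sup>+\<omega>. g (\<lambda>n. X (n + h) \<omega>) \<partial>M) = (\<integral>\<^sup>+\<omega>. g (\<lambda>n. X n \<omega>) \<partial>M)"
proof -
  let ?Q = "PiM UNIV (\<lambda>_. count_space UNIV) :: (int \<Rightarrow> nat) measure"
  have "(\<lambda>\<omega> n. X (n + h) \<omega>) \<in> measurable M ?Q" for h
    by (rule measurable_PiM_single') (auto intro: X)
  then have "(\<integral>\<^sup>+\<omega>. g (\<lambda>n. X (n + h) \<omega>) \<partial>M) = (\<integral>\<^sup>+w. g w \<partial>distr M ?Q (\<lambda>\<omega> n. X (n + h) \<omega>))" for h
    using g by (simp add: nn_integral_distr)
  from this[of h] this[of 0] show ?thesis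
    using st[unfolded strictly_stationary_def, rule_format, of h] by simp
qed

locale square_integrable_inar = subcritical_inar +
  fixes X :: "int \<Rightarrow> 'a \<Rightarrow> nat"
  assumes solution: "stationary_inar_solution M \<epsilon> \<xi> X"
    and square: "\<And>n. (\<integral>\<^sup>+\<omega>. of_nat (X n \<omega>) * of_nat (X n \<omega>) \<partial>M) \<le> ennreal \<sigma>"
begin

lemma measurable_X [measurable]: "X n \<in> measurable M (count_space UNIV)"
  using solution by (simp add: stationary_inar_solution_def)

lemma recursion: "AE \<omega> in M. (of_nat (X n \<omega>) :: ennreal) = of_nat (\<epsilon> n \<omega>)
    + (\<Sum>k. of_nat (\<Sum>l = 1..X (n - int (Suc k)) \<omega>. \<xi> n (Suc k) l \<omega>))"
  using solution by (simp add: stationary_inar_solution_def)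

text \<open>Uncentered and in ennreal, so that the equations hold before integrability is discussed;
  centering involves subtraction and comes later.\<close>

definition moment :: "int \<Rightarrow> ennreal" where
  "moment j = (\<integral>\<^sup>+\<omega>. of_nat (X 0 \<omega>) * of_nat (X j \<omega>) \<partial>M)"

lemma moment_shift: "(\<integral>\<^sup>+\<omega>. of_nat (X m \<omega>) * of_nat (X n \<omega>) \<partial>M) = moment (n - m)"
proof -
  let ?g = "\<lambda>x. of_nat (x 0) * of_nat (x (n - m)) :: ennreal"
  have c: "(\<lambda>x. of_nat (x i) :: ennreal) \<in> borel_measurable (PiM UNIV (\<lambda>_. count_space UNIV))" for i :: int
    by (rule measurable_compose[OF measurable_component_singleton]) auto
  have "(\<integral>\<^sup>+\<omega>. ?g (\<lambda>n. X (n + m) \<omega>) \<partial>M) = (\<integral>\<^sup>+\<omega>. ?g (\<lambda>n. X n \<omega>) \<partial>M)"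
    by (rule nn_integral_strictly_stationary)
       (use solution in \<open>auto simp: stationary_inar_solution_def intro!: borel_measurable_times c\<close>)
  then show ?thesis
    by (simp add: moment_def)
qed

lemma moment_minus: "moment (- j) = moment j"
  using moment_shift[of j 0] by (simp add: moment_def mult.commute)

lemma moment_abs: "moment \<bar>j\<bar> = moment j"
  by (simp add: abs_if moment_minus)

lemma moment_le: "moment j \<le> ennreal \<sigma>"
  unfolding moment_def by (intro nn_integral_of_nat_mult_le[OF _ _ square square] measurable_X)

definition mean :: ennreal where "mean = (\<integral>\<^sup>+\<omega>. of_nat (X 0 \<omega>) \<partial>M)"

lemma mean_shift: "(\<integral>\<^sup>+\<omega>. of_nat (X n \<omega>) \<partial>M) = mean"
proof -
  have c: "(\<lambda>x. of_nat (x 0) :: ennreal) \<in> borel_measurable (PiM (UNIV :: int set) (\<lambda>_. count_space UNIV))"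
    by (rule measurable_compose[OF measurable_component_singleton]) auto
  have "(\<integral>\<^sup>+\<omega>. of_nat ((\<lambda>i. X (i + n) \<omega>) 0) \<partial>M) = (\<integral>\<^sup>+\<omega>. of_nat ((\<lambda>i. X i \<omega>) 0) \<partial>M)"
    by (rule nn_integral_strictly_stationary[OF _ measurable_X c])
       (use solution in \<open>auto simp: stationary_inar_solution_def\<close>)
  then show ?thesis
    by (simp add: mean_def)
qed

lemma mean_less_top: "mean < \<top>"
proof -
  have "mean \<le> (\<integral>\<^sup>+\<omega>. of_nat (X 0 \<omega>) * of_nat (X 0 \<omega>) \<partial>M)"
    unfolding mean_def
  proof (rule nn_integral_mono)
    fix \<omega>
    have "of_nat (X 0 \<omega>) \<le> (of_nat (X 0 \<omega> * X 0 \<omega>) :: ennreal)"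
      by (intro of_nat_mono) simp
    then show "of_nat (X 0 \<omega>) \<le> (of_nat (X 0 \<omega>) * of_nat (X 0 \<omega>) :: ennreal)"
      by simp
  qed
  also have "\<dots> < \<top>"
    using square[of 0] ennreal_less_top by (rule le_less_trans)
  finally show ?thesis .
qed

definition intensity :: "int \<Rightarrow> 'a \<Rightarrow> ennreal" where
  "intensity n \<omega> = ennreal (\<alpha> 0) + (\<Sum>k. ennreal (\<alpha> (Suc k)) * of_nat (X (n - int (Suc k)) \<omega>))"

lemma measurable_intensity_past: "intensity n \<in> borel_measurable (past_algebra M X n)"
proof -
  have [measurable]: "X (n - int (Suc k)) \<in> measurable (past_algebra M X n) (count_space UNIV)" for k
    by (rule measurable_past_algebra) simp
  show ?thesis
    unfolding intensity_def by measurable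
qed

lemma nn_integral_X_past:
  assumes "V \<in> borel_measurable (past_algebra M X n)"
  shows "(\<integral>\<^sup>+\<omega>. V \<omega> * of_nat (X n \<omega>) \<partial>M) = (\<integral>\<^sup>+\<omega>. V \<omega> * intensity n \<omega> \<partial>M)"
    and "(\<integral>\<^sup>+\<omega>. of_nat (X n \<omega>) * of_nat (X n \<omega>) \<partial>M)
      = (\<integral>\<^sup>+\<omega>. intensity n \<omega> * intensity n \<omega> \<partial>M) + (\<integral>\<^sup>+\<omega>. intensity n \<omega> \<partial>M)"
proof -
  let ?S = "\<lambda>\<omega>. of_nat (\<epsilon> n \<omega>) + (\<Sum>k. of_nat (\<Sum>l = 1..X (n - int (Suc k)) \<omega>. \<xi> n (Suc k) l \<omega>)) :: ennreal"
  have ind: "indep_set (noise_sigma M \<epsilon> \<xi> n) (sets (past_algebra M X n))"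
    using solution by (simp add: sets_past_algebra stationary_inar_solution_def)
  have x: "X (n - int (Suc k)) \<in> measurable (past_algebra M X n) (count_space UNIV)" for k
    by (rule measurable_past_algebra) simp
  have "(\<integral>\<^sup>+\<omega>. V \<omega> * of_nat (X n \<omega>) \<partial>M) = (\<integral>\<^sup>+\<omega>. V \<omega> * ?S \<omega> \<partial>M)"
    by (rule nn_integral_cong_AE) (use recursion[of n] in eventually_elim, simp only:)
  also have "\<dots> = (\<integral>\<^sup>+\<omega>. V \<omega> * intensity n \<omega> \<partial>M)"
    unfolding intensity_def by (rule moments_of_offspring_sum(1)[OF ind space_past_algebra x assms])
  finally show "(\<integral>\<^sup>+\<omega>. V \<omega> * of_nat (X n \<omega>) \<partial>M) = (\<integral>\<^sup>+\<omega>. V \<omega> * intensity n \<omega> \<partial>M)" .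
  have "(\<integral>\<^sup>+\<omega>. of_nat (X n \<omega>) * of_nat (X n \<omega>) \<partial>M) = (\<integral>\<^sup>+\<omega>. ?S \<omega> * ?S \<omega> \<partial>M)"
    by (rule nn_integral_cong_AE) (use recursion[of n] in eventually_elim, simp only:)
  also have "\<dots> = (\<integral>\<^sup>+\<omega>. intensity n \<omega> * intensity n \<omega> \<partial>M) + (\<integral>\<^sup>+\<omega>. intensity n \<omega> \<partial>M)"
    unfolding intensity_def by (rule moments_of_offspring_sum(2)[OF ind space_past_algebra x])
  finally show "(\<integral>\<^sup>+\<omega>. of_nat (X n \<omega>) * of_nat (X n \<omega>) \<partial>M)
      = (\<integral>\<^sup>+\<omega>. intensity n \<omega> * intensity n \<omega> \<partial>M) + (\<integral>\<^sup>+\<omega>. intensity n \<omega> \<partial>M)" .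
qed

lemma nn_integral_intensity: "(\<integral>\<^sup>+\<omega>. intensity n \<omega> \<partial>M) = mean"
  using nn_integral_X_past(1)[of "\<lambda>_. 1" n] by (simp add: mean_shift)

text \<open>The linear equation determines the mean only among finite values, hence the appeal to
  \<open>mean_less_top\<close>.\<close>

lemma mean_eq: "mean = ennreal \<mu>"
proof -
  have "(\<integral>\<^sup>+\<omega>. intensity 0 \<omega> \<partial>M) = ennreal (\<alpha> 0) + ennreal K * mean"
    unfolding intensity_def
    by (simp add: nn_integral_add nn_integral_suminf nn_integral_cmult emeasure_space_1 mean_shift
      ennreal_suminf_multc suminf_alpha)
  then have "mean = ennreal (\<alpha> 0) + ennreal K * mean"
    by (simp only: nn_integral_intensity)
  moreover obtain r where r: "mean = ennreal r" "r \<ge> 0"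
    using mean_less_top by (cases mean) auto
  ultimately have "ennreal r = ennreal (\<alpha> 0 + K * r)"
    using nonneg K_nonneg by (simp add: ennreal_mult ennreal_plus)
  then have "r = \<alpha> 0 + K * r"
    using r(2) nonneg K_nonneg by (subst (asm) ennreal_inj) auto
  then have "r = \<mu>"
    using K_less by (simp add: \<mu>_def field_simps)
  with r(1) show ?thesis by simp
qed

lemma nn_integral_intensity_mult:
  "(\<integral>\<^sup>+\<omega>. of_nat (X m \<omega>) * intensity n \<omega> \<partial>M)
     = ennreal (\<alpha> 0 * \<mu>) + (\<Sum>k. ennreal (\<alpha> (Suc k)) * moment (n - m - int (Suc k)))"
proof -
  have "(\<integral>\<^sup>+\<omega>. of_nat (X m \<omega>) * intensity n \<omega> \<partial>M)
      = (\<integral>\<^sup>+\<omega>. ennreal (\<alpha> 0) * of_nat (X m \<omega>)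
          + (\<Sum>k. ennreal (\<alpha> (Suc k)) * (of_nat (X m \<omega>) * of_nat (X (n - int (Suc k)) \<omega>))) \<partial>M)"
    unfolding intensity_def
    by (simp add: distrib_left mult_ac flip: ennreal_suminf_cmult)
  also have "\<dots> = ennreal (\<alpha> 0) * mean
      + (\<Sum>k. ennreal (\<alpha> (Suc k)) * moment (n - int (Suc k) - m))"
    by (simp add: nn_integral_add nn_integral_suminf nn_integral_cmult mean_shift moment_shift del: of_nat_Suc)
  finally show ?thesis
    using nonneg mu_nonneg by (simp add: mean_eq ennreal_mult algebra_simps)
qed

text \<open>For j > 0 the variable \<open>X 0\<close> lies in the past of time \<open>j\<close> and
  may serve as weight. For j = 0 it does not, and the second moment formula takes over; its extra
  summand, the mean intensity, is the source of \<mu>.\<close>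

lemma moment_yule_walker:
  "moment (int j) = (if j = 0 then ennreal \<mu> else 0) + ennreal (\<alpha> 0 * \<mu>)
     + (\<Sum>k. ennreal (\<alpha> (Suc k)) * moment (int j - int (Suc k)))"
proof (cases "j = 0")
  case False
  have "moment (int j) = (\<integral>\<^sup>+\<omega>. of_nat (X 0 \<omega>) * of_nat (X (int j) \<omega>) \<partial>M)"
    by (simp add: moment_def)
  also have "\<dots> = (\<integral>\<^sup>+\<omega>. of_nat (X 0 \<omega>) * intensity (int j) \<omega> \<partial>M)"
    using False by (intro nn_integral_X_past(1) measurable_compose[OF measurable_past_algebra]) auto
  finally show ?thesis
    using False by (simp add: nn_integral_intensity_mult del: of_nat_Suc)
next
  case True
  \<comment> \<open>The squared intensity is traded for \<open>X 0\<close> times the intensity by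
    using the intensity itself as the weight known from the past.\<close>
  have "moment 0 = (\<integral>\<^sup>+\<omega>. of_nat (X 0 \<omega>) * intensity 0 \<omega> \<partial>M) + mean"
    using nn_integral_X_past(2)[OF measurable_intensity_past, of 0]
      nn_integral_X_past(1)[OF measurable_intensity_past, of 0]
    by (simp add: moment_def nn_integral_intensity mult.commute)
  then show ?thesis
    using True by (simp add: nn_integral_intensity_mult mean_eq ac_simps del: of_nat_Suc)
qed

section \<open>Real-valued centered moments and the covariance\<close>

definition centered_moment :: "nat \<Rightarrow> real" where
  "centered_moment j = enn2real (moment (int j)) - \<mu> * \<mu>"

lemma moment_real: "moment j = ennreal (enn2real (moment j))"
  using le_less_trans[OF moment_le ennreal_less_top, of j] by simp

lemma enn2real_moment_le: "enn2real (moment j) \<le> \<sigma>"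
  using moment_le[of j] moment_real[of j] sigma_nonneg by (metis ennreal_le_iff)

lemma centered_moment_yule_walker:
  "centered_moment j = (if j = 0 then \<mu> else 0)
     + (\<Sum>k. \<alpha> (Suc k) * centered_moment (nat \<bar>int j - int (Suc k)\<bar>))"
    and summable_centered_moment:
  "summable (\<lambda>k. \<alpha> (Suc k) * centered_moment (nat \<bar>int j - int (Suc k)\<bar>))"
proof -
  let ?r = "\<lambda>k. enn2real (moment (int j - int (Suc k)))"
  have summ: "summable (\<lambda>k. \<alpha> (Suc k) * ?r k)"
    by (rule summable_comparison_test'[OF summable_mult2[OF sums_summable[OF sums_alpha], of \<sigma>]])
       (use nonneg enn2real_moment_le in \<open>auto simp: abs_mult intro!: mult_left_mono\<close>)
  have "ennreal (enn2real (moment (int j))) = (if j = 0 then ennreal \<mu> else 0) + ennreal (\<alpha> 0 * \<mu>)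
     + (\<Sum>k. ennreal (\<alpha> (Suc k)) * ennreal (?r k))"
    unfolding moment_real[symmetric] by (rule moment_yule_walker)
  also have "\<dots> = ennreal ((if j = 0 then \<mu> else 0) + \<alpha> 0 * \<mu> + (\<Sum>k. \<alpha> (Suc k) * ?r k))"
  proof -
    have "(\<Sum>k. ennreal (\<alpha> (Suc k)) * ennreal (?r k)) = ennreal (\<Sum>k. \<alpha> (Suc k) * ?r k)"
      using nonneg summ by (simp add: suminf_ennreal2 flip: ennreal_mult del: of_nat_Suc)
    moreover have "0 \<le> \<alpha> 0 * \<mu>" "0 \<le> (\<Sum>k. \<alpha> (Suc k) * ?r k)"
      using nonneg mu_nonneg by (auto intro!: suminf_nonneg summ simp del: of_nat_Suc)
    ultimately show ?thesis
      using mu_nonneg by (simp del: of_nat_Suc)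
  qed
  finally have eq: "enn2real (moment (int j)) = (if j = 0 then \<mu> else 0) + \<alpha> 0 * \<mu> + (\<Sum>k. \<alpha> (Suc k) * ?r k)"
    using nonneg mu_nonneg suminf_nonneg[OF summ] by (subst (asm) ennreal_inj) auto
  have c: "\<alpha> (Suc k) * centered_moment (nat \<bar>int j - int (Suc k)\<bar>) = \<alpha> (Suc k) * ?r k - \<alpha> (Suc k) * (\<mu> * \<mu>)" for k
    by (simp add: centered_moment_def moment_abs algebra_simps)
  have s: "(\<lambda>k. \<alpha> (Suc k) * centered_moment (nat \<bar>int j - int (Suc k)\<bar>)) sums
      ((\<Sum>k. \<alpha> (Suc k) * ?r k) - K * (\<mu> * \<mu>))"
    unfolding c by (intro sums_diff summable_sums summ sums_mult2 sums_alpha)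
  \<comment> \<open>Centering removes the constant \<alpha> 0 * \<mu> from the equation precisely
    because \<mu> is the fixed point of the mean equation.\<close>
  have "\<alpha> 0 * \<mu> + K * (\<mu> * \<mu>) = \<mu> * \<mu>"
    using mu_eq by (metis distrib_right mult.assoc)
  then show "centered_moment j = (if j = 0 then \<mu> else 0)
     + (\<Sum>k. \<alpha> (Suc k) * centered_moment (nat \<bar>int j - int (Suc k)\<bar>))"
    unfolding sums_unique[OF s, symmetric] by (simp add: centered_moment_def eq)
  show "summable (\<lambda>k. \<alpha> (Suc k) * centered_moment (nat \<bar>int j - int (Suc k)\<bar>))"
    using s by (rule sums_summable)
qed

text \<open>Both sides have the same inhomogeneity, \<mu> at j = 0, so their difference solves the
  homogeneous equation. Summability of both series is required to split the series of the
  difference.\<close>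

lemma centered_moment_eq: "centered_moment j = \<mu> * inar_gamma \<alpha> j"
proof -
  let ?d = "\<lambda>j. centered_moment j - \<mu> * inar_gamma \<alpha> j"
  have "?d j = 0" for j
  proof (rule bounded_convolution_solution_eq_0[OF nonneg sums_alpha K_less])
    fix j
    have "\<bar>centered_moment j\<bar> \<le> \<sigma> + \<mu> * \<mu>"
      unfolding centered_moment_def
      using enn2real_moment_le[of "int j"] enn2real_nonneg[of "moment (int j)"] zero_le_square[of \<mu>]
      unfolding abs_le_iff by linarith
    moreover have "\<bar>\<mu> * inar_gamma \<alpha> j\<bar> \<le> \<mu> * (1 / (1 - K)\<^sup>2)"
      using mu_nonneg inar_gamma_nonneg[OF nonneg sums_alpha K_less, of j]
        inar_gamma_le[OF nonneg sums_alpha K_less, of j]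
      by (simp add: abs_mult mult_left_mono del: times_divide_eq_right)
    ultimately show "\<bar>?d j\<bar> \<le> (\<sigma> + \<mu> * \<mu>) + \<mu> * (1 / (1 - K)\<^sup>2)"
      by linarith
  next
    fix j
    let ?g = "\<lambda>k. \<alpha> (Suc k) * inar_gamma \<alpha> (nat \<bar>int j - int (Suc k)\<bar>)"
    let ?c = "\<lambda>k. \<alpha> (Suc k) * centered_moment (nat \<bar>int j - int (Suc k)\<bar>)"
    have summ: "summable ?g"
      by (rule summable_comparison_test'[OF summable_mult2[OF sums_summable[OF sums_alpha], of "1 / (1 - K)\<^sup>2"]])
         (use nonneg inar_gamma_nonneg[OF nonneg sums_alpha K_less] inar_gamma_le[OF nonneg sums_alpha K_less]
           in \<open>auto simp: abs_mult intro!: mult_left_mono simp del: times_divide_eq_right\<close>)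
    have "(\<lambda>k. ?c k - \<mu> * ?g k) sums ((\<Sum>k. ?c k) - \<mu> * (\<Sum>k. ?g k))"
      by (intro sums_diff sums_mult summable_sums summ summable_centered_moment)
    then have "(\<Sum>k. \<alpha> (Suc k) * ?d (nat \<bar>int j - int (Suc k)\<bar>)) = (\<Sum>k. ?c k) - \<mu> * (\<Sum>k. ?g k)"
      by (simp add: sums_iff algebra_simps)
    then show "?d j = (\<Sum>k. \<alpha> (Suc k) * ?d (nat \<bar>int j - int (Suc k)\<bar>))"
      by (subst centered_moment_yule_walker, subst inar_gamma_yule_walker[OF nonneg sums_alpha K_less])
         (simp add: distrib_left del: of_nat_Suc)
  qed
  then show ?thesis by simp
qed

lemma has_integral_mult:
  "has_bochner_integral M (\<lambda>\<omega>. real (X m \<omega>) * real (X n \<omega>)) (enn2real (moment (n - m)))"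
proof (rule has_bochner_integral_nn_integral)
  have "(\<integral>\<^sup>+\<omega>. ennreal (real (X m \<omega>) * real (X n \<omega>)) \<partial>M) = moment (n - m)"
    by (simp add: ennreal_mult moment_shift flip: ennreal_of_nat_eq_real_of_nat)
  also have "\<dots> = ennreal (enn2real (moment (n - m)))"
    by (rule moment_real)
  finally show "(\<integral>\<^sup>+\<omega>. ennreal (real (X m \<omega>) * real (X n \<omega>)) \<partial>M) = ennreal (enn2real (moment (n - m)))" .
qed auto

lemma has_integral_mean: "has_bochner_integral M (\<lambda>\<omega>. real (X n \<omega>)) \<mu>"
  by (rule has_bochner_integral_nn_integral)
     (auto simp: mu_nonneg mean_eq mean_shift simp flip: ennreal_of_nat_eq_real_of_nat)

lemma covariance_eq: "covariance M (\<lambda>\<omega>. real (X n \<omega>)) (\<lambda>\<omega>. real (X (n + j) \<omega>)) = \<mu> * inar_gamma \<alpha> (nat \<bar>j\<bar>)"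
proof -
  have "has_bochner_integral M (\<lambda>\<omega>. real (X n \<omega>) * real (X (n + j) \<omega>) - real (X n \<omega>) * \<mu>
      - real (X (n + j) \<omega>) * \<mu> + \<mu> * \<mu>) (enn2real (moment (n + j - n)) - \<mu> * \<mu> - \<mu> * \<mu> + \<mu> * \<mu>)"
  proof -
    have "has_bochner_integral M (\<lambda>_. \<mu> * \<mu>) (\<mu> * \<mu>)"
      by (simp add: has_bochner_integral_iff prob_space)
    then show ?thesis
      by (rule has_bochner_integral_add[rotated])
         (intro has_bochner_integral_diff has_integral_mult has_bochner_integral_mult_left has_integral_mean)
  qed
  then have "covariance M (\<lambda>\<omega>. real (X n \<omega>)) (\<lambda>\<omega>. real (X (n + j) \<omega>)) = enn2real (moment j) - \<mu> * \<mu>"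
    unfolding covariance_def has_bochner_integral_integral_eq[OF has_integral_mean]
    by (auto dest!: has_bochner_integral_integral_eq simp: algebra_simps)
  also have "\<dots> = centered_moment (nat \<bar>j\<bar>)"
    by (simp add: centered_moment_def moment_abs)
  finally show ?thesis
    by (simp add: centered_moment_eq)
qed

end

theorem proposition4:
  fixes M :: "'a measure" and \<alpha> :: "nat \<Rightarrow> real" and K :: real
    and \<epsilon> X :: "int \<Rightarrow> 'a \<Rightarrow> nat" and \<xi> :: "int \<Rightarrow> nat \<Rightarrow> nat \<Rightarrow> 'a \<Rightarrow> nat"
    and R :: "int \<Rightarrow> int \<Rightarrow> real"
  assumes alpha_nonneg: "\<And>k. \<alpha> k \<ge> 0"
    and alpha_sums: "(\<lambda>k. \<alpha> (Suc k)) sums K" and K_less: "K < 1"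
    and X: "inar_process M \<alpha> \<epsilon> \<xi> X"
    and R_def: "\<And>n j. R n j = covariance M (\<lambda>\<omega>. real (X n \<omega>)) (\<lambda>\<omega>. real (X (n + j) \<omega>))"
  shows "(\<forall>n. integrable M (\<lambda>\<omega>. (real (X n \<omega>))\<^sup>2)) \<and>
     (\<forall>n j. summable (\<lambda>k. inar_beta \<alpha> k * inar_beta \<alpha> (k + nat \<bar>j\<bar>)) \<and>
        R n j = \<alpha> 0 / (1 - K) * (\<Sum>k. inar_beta \<alpha> k * inar_beta \<alpha> (k + nat \<bar>j\<bar>)) \<and>
        R n j \<ge> 0) \<and>
     (\<forall>n. summable (\<lambda>j. R n (int j)) \<and> (\<Sum>j. R n (int j)) \<le> \<alpha> 0 / (1 - K) ^ 3)"
proof -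
  interpret subcritical_inar M \<alpha> \<epsilon> \<xi> K
    using X alpha_nonneg alpha_sums K_less by unfold_locales (auto simp: inar_process_def)
  have limit_eq: "AE \<omega> in M. \<forall>n. limit n \<omega> = X n \<omega>"
    using X stationary_inar_solution_limit by (auto simp: inar_process_def)
  interpret square_integrable_inar M \<alpha> \<epsilon> \<xi> K X
  proof
    show "stationary_inar_solution M \<epsilon> \<xi> X"
      using X by (simp add: inar_process_def)
    fix n
    have "(\<integral>\<^sup>+\<omega>. of_nat (X n \<omega>) * of_nat (X n \<omega>) \<partial>M) = (\<integral>\<^sup>+\<omega>. of_nat (limit n \<omega>) * of_nat (limit n \<omega>) \<partial>M)"
      by (rule nn_integral_cong_AE) (use limit_eq in eventually_elim, simp)
    also have "\<dots> \<le> ennreal \<sigma>"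
      by (rule square_moment_limit)
    finally show "(\<integral>\<^sup>+\<omega>. of_nat (X n \<omega>) * of_nat (X n \<omega>) \<partial>M) \<le> ennreal \<sigma>" .
  qed
  have R: "R n j = \<mu> * inar_gamma \<alpha> (nat \<bar>j\<bar>)" for n j
    by (simp add: R_def covariance_eq)
  have R_nonneg: "R n j \<ge> 0" for n j
    unfolding R by (intro mult_nonneg_nonneg mu_nonneg inar_gamma_nonneg[OF alpha_nonneg alpha_sums K_less])
  \<comment> \<open>A bound on all partial sums yields both the summability and the bound on the
    sum. The third power is the square from \<open>sum_inar_gamma_le\<close> times the denominator
    of \<mu>.\<close>
  have sum_R: "(\<Sum>j<m. R n (int j)) \<le> \<alpha> 0 / (1 - K) ^ 3" for n m
  proof -
    have "(\<Sum>j<m. R n (int j)) = \<mu> * (\<Sum>j<m. inar_gamma \<alpha> j)"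
      by (simp add: R sum_distrib_left)
    also have "\<dots> \<le> \<mu> * (1 / (1 - K)\<^sup>2)"
      by (intro mult_left_mono sum_inar_gamma_le[OF alpha_nonneg alpha_sums K_less] mu_nonneg)
    also have "\<dots> = \<alpha> 0 / (1 - K) ^ 3"
      by (simp add: \<mu>_def power2_eq_square power3_eq_cube)
    finally show ?thesis .
  qed
  have "integrable M (\<lambda>\<omega>. (real (X n \<omega>))\<^sup>2)" for n
    unfolding power2_eq_square by (rule integrable.intros[OF has_integral_mult])
  moreover have "summable (\<lambda>j. R n (int j))" for n
    by (rule summableI_nonneg_bounded[OF R_nonneg sum_R])
  moreover from this have "(\<Sum>j. R n (int j)) \<le> \<alpha> 0 / (1 - K) ^ 3" for n
    by (rule suminf_le_const) (rule sum_R)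
  ultimately show ?thesis
    using R R_nonneg summable_inar_gamma[OF alpha_nonneg alpha_sums K_less]
    by (auto simp: inar_gamma_def \<mu>_def)
qed

end
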